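(* Let $\Gamma$ be a connected finite simple graph with first Betti number $b_1\geq 2$. Let $S\leq\mathrm{Aut}(F(\Gamma))$ be the subgroup of automorphisms of $F(\Gamma)$ that fix each intersection vertex (each vertex of $F(\Gamma)\cap\mathrm{Cyc}(\Gamma)$). Then $\ker(\phi^1_\Gamma)\cong S$.
   Context: $b_1$ is the number of independent cycles. Cycle-forest decomposition: let $F_1$ be the set of leaves (degree-1 vertices) of $\Gamma$, and recursively let $F_j$ be the set of leaves of $\Gamma-\bigcup_{i<j}F_i$ (removing vertices with their incident edges), until $F_j=\emptyset$ for all $j>k$. $F(\Gamma)$ is the subgraph consisting of the vertices of $\bigcup_{i=1}^kF_i$ together with all edges of $\Gamma$ incident to them (and their endpoints); $\mathrm{Cyc}(\Gamma)=\Gamma-\bigcup_{i=1}^kF_i$; intersection vertices are those lying in both. $\Omega^1(\Gamma)$ is the space of real functions $f$ on ordered pairs $(v,w)$ of adjacent vertices with $f(v,w)=-f(w,v)$; $D$ maps a vertex function $u$ to $Du(v,w)=u(w)-u(v)$; $H^1(\Gamma)=\Omega^1(\Gamma)/\mathrm{Im}(D)$. Each $g\in\mathrm{Aut}(\Gamma)$ acts by pullback $g^*f(v,w)=f(g(v),g(w))$, descending to $H^1(\Gamma)$; $\phi^1_\Gamma(g)=(g^* )^{-1}$. *)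

theory Defs
  imports
    Complex_Main
    "HOL-Library.Function_Algebras"
    "HOL-Algebra.Bij"
    "HOL-Algebra.Coset"
    "Graph_Theory.Graph_Theory"
begin

text \<open>
  A finite simple graph is a \<open>pair_graph\<close>: a finite, symmetric, loop-free relation \<open>parcs\<close>
  on \<open>pverts\<close>.  Thus \<open>parcs G\<close> is the set of ordered pairs of adjacent vertices, and
  the degree of a vertex is its out-degree.
\<close>

section \<open>Real functions as a vector space\<close>

instantiation "fun" :: (type, real_vector) real_vector
begin

definition scaleR_fun :: "real \<Rightarrow> ('a \<Rightarrow> 'b) \<Rightarrow> 'a \<Rightarrow> 'b"
  where "scaleR_fun c f = (\<lambda>x. c *\<^sub>R f x)"

instance
  by standard (simp_all add: scaleR_fun_def plus_fun_def fun_eq_iff algebra_simps)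

end


section \<open>First Betti number\<close>

text \<open>
  The 1-chain of a closed walk: each traversed arc counts +1, its reversal -1.
\<close>

definition cycle_vector :: "('v \<times> 'v) list \<Rightarrow> 'v \<times> 'v \<Rightarrow> real"
  where "cycle_vector p = (\<lambda>(v, w). real (count_list p (v, w)) - real (count_list p (w, v)))"

text \<open>
  The number of independent cycles.  The library predicate \<open>cycle\<close> also admits
  the closed walk going forth and back along one edge, hence the bound on the length.
\<close>

definition betti1 :: "'v pair_pre_digraph \<Rightarrow> nat"
  where "betti1 G = dim {cycle_vector p | p. pre_digraph.cycle (with_proj G) p \<and> 3 \<le> length p}"


section \<open>Cycle-forest decomposition\<close>

definition leaves :: "('v, 'e) pre_digraph \<Rightarrow> 'v set"
  where "leaves H = {v \<in> verts H. out_degree H v = 1}"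

text \<open>\<open>leaf_layer G j\<close> is the set $F_{j+1}$.\<close>

fun leaf_layer :: "'v pair_pre_digraph \<Rightarrow> nat \<Rightarrow> 'v set"
  where "leaf_layer G j =
    leaves (with_proj G \<restriction> (pverts G - (\<Union>i\<in>{..<j}. leaf_layer G i)))"

declare leaf_layer.simps [simp del]

definition pruned :: "'v pair_pre_digraph \<Rightarrow> 'v set"
  where "pruned G = (\<Union>j. leaf_layer G j)"

definition forest_part :: "'v pair_pre_digraph \<Rightarrow> 'v pair_pre_digraph"
  where "forest_part G =
    \<lparr>pverts = pruned G \<union> {w. \<exists>v\<in>pruned G. (v, w) \<in> parcs G},
     parcs = {(v, w) \<in> parcs G. v \<in> pruned G \<or> w \<in> pruned G}\<rparr>"

definition cyc_part :: "'v pair_pre_digraph \<Rightarrow> ('v, 'v \<times> 'v) pre_digraph"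
  where "cyc_part G = with_proj G \<restriction> (pverts G - pruned G)"

definition intersection_verts :: "'v pair_pre_digraph \<Rightarrow> 'v set"
  where "intersection_verts G = pverts (forest_part G) \<inter> verts (cyc_part G)"


section \<open>Automorphism groups\<close>

definition graph_auts :: "'v pair_pre_digraph \<Rightarrow> ('v \<Rightarrow> 'v) set"
  where "graph_auts G = {g \<in> Bij (pverts G).
    \<forall>v\<in>pverts G. \<forall>w\<in>pverts G. (g v, g w) \<in> parcs G \<longleftrightarrow> (v, w) \<in> parcs G}"

definition Aut :: "'v pair_pre_digraph \<Rightarrow> ('v \<Rightarrow> 'v) monoid"
  where "Aut G = (BijGroup (pverts G))\<lparr>carrier := graph_auts G\<rparr>"

definition forest_stabilizer :: "'v pair_pre_digraph \<Rightarrow> ('v \<Rightarrow> 'v) set"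
  where "forest_stabilizer G =
    {g \<in> carrier (Aut (forest_part G)). \<forall>v\<in>intersection_verts G. g v = v}"


section \<open>First cohomology\<close>

text \<open>Functions on \<open>parcs G\<close> are extended by zero to all pairs.\<close>

definition Omega1 :: "'v pair_pre_digraph \<Rightarrow> ('v \<times> 'v \<Rightarrow> real) set"
  where "Omega1 G = {f. (\<forall>a. a \<notin> parcs G \<longrightarrow> f a = 0) \<and>
    (\<forall>(v, w)\<in>parcs G. f (v, w) = - f (w, v))}"

definition coboundary :: "'v pair_pre_digraph \<Rightarrow> ('v \<Rightarrow> real) \<Rightarrow> 'v \<times> 'v \<Rightarrow> real"
  where "coboundary G u = (\<lambda>(v, w). if (v, w) \<in> parcs G then u w - u v else 0)"

definition H1_class :: "'v pair_pre_digraph \<Rightarrow> ('v \<times> 'v \<Rightarrow> real) \<Rightarrow> ('v \<times> 'v \<Rightarrow> real) set"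
  where "H1_class G f = {f + b | b. b \<in> range (coboundary G)}"

definition H1 :: "'v pair_pre_digraph \<Rightarrow> ('v \<times> 'v \<Rightarrow> real) set set"
  where "H1 G = H1_class G ` Omega1 G"

text \<open>Operations on the quotient, via representatives; see the three lemmas
  \<open>H1_add_class\<close>, \<open>H1_scale_class\<close>, \<open>H1_pullback_class\<close> for well-definedness.\<close>

definition H1_add where
  "H1_add G X Y = (\<Union>x\<in>X. \<Union>y\<in>Y. H1_class G (x + y))"

definition H1_scale where
  "H1_scale G c X = (\<Union>x\<in>X. H1_class G (c *\<^sub>R x))"

definition pullback :: "'v pair_pre_digraph \<Rightarrow> ('v \<Rightarrow> 'v) \<Rightarrow> ('v \<times> 'v \<Rightarrow> real) \<Rightarrow> 'v \<times> 'v \<Rightarrow> real"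
  where "pullback G g f = (\<lambda>(v, w). if (v, w) \<in> parcs G then f (g v, g w) else 0)"

definition H1_pullback ::
    "'v pair_pre_digraph \<Rightarrow> ('v \<Rightarrow> 'v) \<Rightarrow> ('v \<times> 'v \<Rightarrow> real) set \<Rightarrow> ('v \<times> 'v \<Rightarrow> real) set"
  where "H1_pullback G g = (\<lambda>X\<in>H1 G. \<Union>x\<in>X. H1_class G (pullback G g x))"

definition GL_H1 :: "'v pair_pre_digraph \<Rightarrow> (('v \<times> 'v \<Rightarrow> real) set \<Rightarrow> ('v \<times> 'v \<Rightarrow> real) set) monoid"
  where "GL_H1 G = (BijGroup (H1 G))\<lparr>carrier := {\<phi> \<in> Bij (H1 G).
    (\<forall>X\<in>H1 G. \<forall>Y\<in>H1 G. \<phi> (H1_add G X Y) = H1_add G (\<phi> X) (\<phi> Y)) \<and>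
    (\<forall>c. \<forall>X\<in>H1 G. \<phi> (H1_scale G c X) = H1_scale G c (\<phi> X))}\<rparr>"

definition phi1 ::
    "'v pair_pre_digraph \<Rightarrow> ('v \<Rightarrow> 'v) \<Rightarrow> ('v \<times> 'v \<Rightarrow> real) set \<Rightarrow> ('v \<times> 'v \<Rightarrow> real) set"
  where "phi1 G g = inv\<^bsub>GL_H1 G\<^esub> (H1_pullback G g)"


section \<open>The structures are well defined\<close>

lemma coboundary_add: "coboundary G u + coboundary G v = coboundary G (u + v)"
  by (auto simp: coboundary_def fun_eq_iff)

lemma coboundary_scale: "c *\<^sub>R coboundary G u = coboundary G (c *\<^sub>R u)"
  by (auto simp: coboundary_def fun_eq_iff scaleR_fun_def algebra_simps)

lemma coboundary_zero: "0 = coboundary G 0"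
  by (auto simp: coboundary_def fun_eq_iff)

lemma coboundary_uminus: "- coboundary G u = coboundary G (- u)"
  by (auto simp: coboundary_def fun_eq_iff)

lemma pullback_add: "pullback G g (x + y) = pullback G g x + pullback G g y"
  by (auto simp: pullback_def fun_eq_iff)

lemma pullback_scale: "pullback G g (c *\<^sub>R x) = c *\<^sub>R pullback G g x"
  by (auto simp: pullback_def fun_eq_iff scaleR_fun_def)

lemma graph_auts_arc:
  assumes "pair_wf_digraph G" "g \<in> graph_auts G" "(v, w) \<in> parcs G"
  shows "(g v, g w) \<in> parcs G"
  using assms(2,3) pair_wf_digraph.in_arcsD1[OF assms(1,3)] pair_wf_digraph.in_arcsD2[OF assms(1,3)]
  by (simp add: graph_auts_def)

lemma pullback_coboundary:
  assumes "pair_wf_digraph G" "g \<in> graph_auts G"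
  shows "pullback G g (coboundary G u) = coboundary G (u \<circ> g)"
proof
  fix a :: "'a \<times> 'a"
  obtain v w where a: "a = (v, w)" by fastforce
  show "pullback G g (coboundary G u) a = coboundary G (u \<circ> g) a"
  proof (cases "(v, w) \<in> parcs G")
    case True
    from graph_auts_arc[OF assms this] True show ?thesis
      by (simp add: a pullback_def coboundary_def)
  qed (simp add: a pullback_def coboundary_def)
qed

lemma coboundary_Omega1:
  assumes "pair_graph G" shows "coboundary G u \<in> Omega1 G"
proof -
  interpret pair_graph G by fact
  have "(w, v) \<in> parcs G" if "(v, w) \<in> parcs G" for v w
    using that arcs_symmetric by blast
  then show ?thesis by (auto simp: coboundary_def Omega1_def)
qed

lemma H1_class_shift: "H1_class G (f + coboundary G u) = H1_class G f"
proof -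
  have "H1_class G (f + coboundary G u) \<subseteq> H1_class G f" for f u
    unfolding H1_class_def by (auto simp: add.assoc coboundary_add)
  from this[of f u] this[of "f + coboundary G u" "- u"] show ?thesis
    by (auto simp: add.assoc coboundary_uminus[symmetric])
qed

lemma H1_class_self: "f \<in> H1_class G f"
  unfolding H1_class_def using coboundary_zero[of G]
  by (metis (mono_tags, lifting) add.right_neutral mem_Collect_eq rangeI)

lemma H1_class_eq_iff: "H1_class G f = H1_class G g \<longleftrightarrow> f - g \<in> range (coboundary G)"
proof
  assume "H1_class G f = H1_class G g"
  then have "f \<in> H1_class G g" using H1_class_self by blast
  then show "f - g \<in> range (coboundary G)" by (auto simp: H1_class_def)
next
  assume "f - g \<in> range (coboundary G)"
  then obtain u where "f = g + coboundary G u" by (auto simp: algebra_simps)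
  then show "H1_class G f = H1_class G g" by (simp add: H1_class_shift)
qed

lemma H1_add_class: "H1_add G (H1_class G x) (H1_class G y) = H1_class G (x + y)"
proof -
  have "H1_class G (a + b) = H1_class G (x + y)"
    if "a \<in> H1_class G x" "b \<in> H1_class G y" for a b
  proof -
    from that obtain u v where "a = x + coboundary G u" "b = y + coboundary G v"
      by (auto simp: H1_class_def)
    then have "a + b = (x + y) + coboundary G (u + v)"
      by (simp add: coboundary_add[symmetric] algebra_simps)
    then show ?thesis by (simp only: H1_class_shift)
  qed
  then show ?thesis unfolding H1_add_def using H1_class_self by blast
qed

lemma H1_scale_class: "H1_scale G c (H1_class G x) = H1_class G (c *\<^sub>R x)"
proof -
  have "H1_class G (c *\<^sub>R a) = H1_class G (c *\<^sub>R x)" if "a \<in> H1_class G x" for a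
    using that
    by (auto simp: H1_class_def[of G x] scaleR_add_right coboundary_scale H1_class_shift)
  then show ?thesis unfolding H1_scale_def using H1_class_self by blast
qed

lemma pullback_Omega1:
  assumes "pair_graph G" "g \<in> graph_auts G" "f \<in> Omega1 G"
  shows "pullback G g f \<in> Omega1 G"
proof -
  interpret pair_graph G by fact
  have "pullback G g f (v, w) = - pullback G g f (w, v)" if "(v, w) \<in> parcs G" for v w
  proof -
    have "(w, v) \<in> parcs G" using that arcs_symmetric by blast
    moreover have "f (g v, g w) = - f (g w, g v)"
      using assms(3) graph_auts_arc[OF pair_wf_digraph assms(2) that] by (auto simp: Omega1_def)
    ultimately show ?thesis using that by (simp add: pullback_def)
  qed
  then show ?thesis by (auto simp: Omega1_def pullback_def)
qed

lemma H1_pullback_class: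
  assumes "pair_wf_digraph G" "g \<in> graph_auts G" "f \<in> Omega1 G"
  shows "H1_pullback G g (H1_class G f) = H1_class G (pullback G g f)"
proof -
  have "H1_class G (pullback G g a) = H1_class G (pullback G g f)" if "a \<in> H1_class G f" for a
    using that
    by (auto simp: H1_class_def[of G f] pullback_add pullback_coboundary[OF assms(1,2)]
        H1_class_shift)
  then show ?thesis
    unfolding H1_pullback_def using H1_class_self assms(3) by (auto simp: H1_def) blast+
qed

lemma Omega1I:
  assumes "\<And>a. a \<notin> parcs G \<Longrightarrow> f a = 0"
    and "\<And>v w. (v, w) \<in> parcs G \<Longrightarrow> f (v, w) = - f (w, v)"
  shows "f \<in> Omega1 G"
  using assms unfolding Omega1_def by blast

lemma Omega1D:
  assumes "f \<in> Omega1 G"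
  shows "a \<notin> parcs G \<Longrightarrow> f a = 0"
    and "(v, w) \<in> parcs G \<Longrightarrow> f (v, w) = - f (w, v)"
  using assms unfolding Omega1_def by blast+

lemma Omega1_add:
  assumes "f \<in> Omega1 G" "h \<in> Omega1 G" shows "f + h \<in> Omega1 G"
proof (rule Omega1I)
  fix v w assume "(v, w) \<in> parcs G"
  from Omega1D(2)[OF assms(1) this] Omega1D(2)[OF assms(2) this]
  show "(f + h) (v, w) = - (f + h) (w, v)" unfolding plus_fun_apply by linarith
qed (simp add: Omega1D(1)[OF assms(1)] Omega1D(1)[OF assms(2)])

lemma Omega1_scale:
  assumes "f \<in> Omega1 G" shows "c *\<^sub>R f \<in> Omega1 G"
proof (rule Omega1I)
  fix v w assume "(v, w) \<in> parcs G"
  then show "(c *\<^sub>R f) (v, w) = - (c *\<^sub>R f) (w, v)"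
    by (simp add: scaleR_fun_def Omega1D(2)[OF assms, of v w])
qed (simp add: scaleR_fun_def Omega1D(1)[OF assms])

lemma H1_add_closed: "X \<in> H1 G \<Longrightarrow> Y \<in> H1 G \<Longrightarrow> H1_add G X Y \<in> H1 G"
  by (auto simp: H1_def H1_add_class Omega1_add)

lemma H1_scale_closed: "X \<in> H1 G \<Longrightarrow> H1_scale G c X \<in> H1 G"
  by (auto simp: H1_def H1_scale_class Omega1_scale)

lemma BijGroup_subgroupI:
  assumes "H \<subseteq> Bij S" "(\<lambda>x\<in>S. x) \<in> H"
    and "\<And>f g. f \<in> H \<Longrightarrow> g \<in> H \<Longrightarrow> compose S f g \<in> H"
    and "\<And>f. f \<in> H \<Longrightarrow> (\<lambda>x\<in>S. inv_into S f x) \<in> H"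
  shows "subgroup H (BijGroup S)"
proof (rule group.subgroupI[OF group_BijGroup])
  show "H \<subseteq> carrier (BijGroup S)" using assms(1) by (simp add: BijGroup_def)
  show "H \<noteq> {}" using assms(2) by blast
  show "inv\<^bsub>BijGroup S\<^esub> f \<in> H" if "f \<in> H" for f
    using that assms(1,4) by (auto simp: inv_BijGroup)
  show "f \<otimes>\<^bsub>BijGroup S\<^esub> g \<in> H" if "f \<in> H" "g \<in> H" for f g
  proof -
    have "f \<in> Bij S" "g \<in> Bij S" using that assms(1) by auto
    then show ?thesis using assms(3)[OF that] by (simp add: BijGroup_def)
  qed
qed

lemma Bij_apply: "f \<in> Bij S \<Longrightarrow> x \<in> S \<Longrightarrow> f x \<in> S"
  using Bij_imp_funcset by blast

lemma Bij_f_inv: "f \<in> Bij S \<Longrightarrow> x \<in> S \<Longrightarrow> f (inv_into S f x) = x"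
  unfolding Bij_def using bij_betw_inv_into_right by fast

lemma Bij_inv_f: "f \<in> Bij S \<Longrightarrow> x \<in> S \<Longrightarrow> inv_into S f (f x) = x"
  unfolding Bij_def using bij_betw_inv_into_left by fast

lemma subgroup_graph_auts: "subgroup (graph_auts G) (BijGroup (pverts G))"
proof (rule BijGroup_subgroupI)
  show "(\<lambda>x\<in>pverts G. x) \<in> graph_auts G" by (simp add: graph_auts_def id_Bij)
  show "compose (pverts G) f g \<in> graph_auts G" if "f \<in> graph_auts G" "g \<in> graph_auts G" for f g
    using that by (auto simp: graph_auts_def compose_Bij compose_eq Bij_apply)
  show "(\<lambda>x\<in>pverts G. inv_into (pverts G) f x) \<in> graph_auts G" if f: "f \<in> graph_auts G" for f
  proof -
    have b: "f \<in> Bij (pverts G)" using f by (simp add: graph_auts_def)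
    have "(inv_into (pverts G) f v, inv_into (pverts G) f w) \<in> parcs G \<longleftrightarrow> (v, w) \<in> parcs G"
      if "v \<in> pverts G" "w \<in> pverts G" for v w
    proof -
      let ?v = "inv_into (pverts G) f v" and ?w = "inv_into (pverts G) f w"
      have "?v \<in> pverts G" "?w \<in> pverts G"
        using Bij_inv_into_mem[OF b] that by auto
      then have "(f ?v, f ?w) \<in> parcs G \<longleftrightarrow> (?v, ?w) \<in> parcs G"
        using f unfolding graph_auts_def by blast
      then show ?thesis by (simp only: Bij_f_inv[OF b that(1)] Bij_f_inv[OF b that(2)])
    qed
    then show ?thesis using b by (simp add: graph_auts_def restrict_inv_into_Bij)
  qed
qed (auto simp: graph_auts_def)

lemma group_Aut: "group (Aut G)"
  unfolding Aut_def by (rule group.subgroup_imp_group[OF group_BijGroup subgroup_graph_auts])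

lemma group_GL_H1: "group (GL_H1 G)"
  unfolding GL_H1_def
proof (rule group.subgroup_imp_group[OF group_BijGroup BijGroup_subgroupI], goal_cases)
  case 1 then show ?case by blast
next
  case 2 then show ?case by (simp add: id_Bij H1_add_closed H1_scale_closed)
next
  case (3 f g)
  then show ?case
    by (simp add: compose_Bij compose_eq Bij_apply H1_add_closed H1_scale_closed)
next
  case (4 f)
  let ?i = "inv_into (H1 G) f"
  have b: "f \<in> Bij (H1 G)" using 4 by simp
  have m: "X \<in> H1 G \<Longrightarrow> ?i X \<in> H1 G" for X using Bij_inv_into_mem[OF b] .
  have "?i (H1_add G X Y) = H1_add G (?i X) (?i Y)" if "X \<in> H1 G" "Y \<in> H1 G" for X Y
  proof -
    have "f (H1_add G (?i X) (?i Y)) = H1_add G (f (?i X)) (f (?i Y))"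
      using 4 m[OF that(1)] m[OF that(2)] by blast
    then have "f (H1_add G (?i X) (?i Y)) = H1_add G X Y"
      by (simp only: Bij_f_inv[OF b that(1)] Bij_f_inv[OF b that(2)])
    moreover have "H1_add G (?i X) (?i Y) \<in> H1 G"
      using H1_add_closed[OF m[OF that(1)] m[OF that(2)]] .
    ultimately show ?thesis using Bij_inv_f[OF b] by fastforce
  qed
  moreover have "?i (H1_scale G c X) = H1_scale G c (?i X)" if "X \<in> H1 G" for X c
  proof -
    have "f (H1_scale G c (?i X)) = H1_scale G c (f (?i X))"
      using 4 m[OF that] by blast
    then have "f (H1_scale G c (?i X)) = H1_scale G c X"
      by (simp only: Bij_f_inv[OF b that])
    moreover have "H1_scale G c (?i X) \<in> H1 G"
      using H1_scale_closed[OF m[OF that]] .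
    ultimately show ?thesis using Bij_inv_f[OF b] by fastforce
  qed
  ultimately show ?case
    using b by (simp add: restrict_inv_into_Bij H1_add_closed H1_scale_closed)
qed

lemma pverts_forest_part_intersection:
  "intersection_verts G \<subseteq> pverts (forest_part G)"
  by (auto simp: intersection_verts_def)

lemma subgroup_forest_stabilizer: "subgroup (forest_stabilizer G) (Aut (forest_part G))"
proof -
  let ?F = "forest_part G" and ?V = "pverts (forest_part G)"
  have I: "intersection_verts G \<subseteq> ?V" by (rule pverts_forest_part_intersection)
  have S: "forest_stabilizer G \<subseteq> graph_auts ?F"
    by (auto simp: forest_stabilizer_def Aut_def)
  interpret B: subgroup "graph_auts ?F" "BijGroup ?V" by (rule subgroup_graph_auts)
  have inB: "graph_auts ?F \<subseteq> Bij ?V" by (auto simp: graph_auts_def)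
  have "subgroup (forest_stabilizer G) (BijGroup ?V)"
  proof (rule BijGroup_subgroupI)
    show "forest_stabilizer G \<subseteq> Bij ?V" using S inB by blast
    show "(\<lambda>x\<in>?V. x) \<in> forest_stabilizer G"
      using I B.one_closed by (auto simp: forest_stabilizer_def Aut_def BijGroup_def)
    show "compose ?V f g \<in> forest_stabilizer G"
      if "f \<in> forest_stabilizer G" "g \<in> forest_stabilizer G" for f g
    proof -
      have "f \<in> graph_auts ?F" "g \<in> graph_auts ?F" using that S by auto
      moreover from this have "f \<in> Bij ?V" "g \<in> Bij ?V" using inB by auto
      ultimately have "compose ?V f g \<in> graph_auts ?F"
        using B.m_closed[of f g] by (simp add: BijGroup_def)
      then show ?thesis
        using that I by (auto simp: forest_stabilizer_def Aut_def compose_def)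
    qed
    show "(\<lambda>x\<in>?V. inv_into ?V f x) \<in> forest_stabilizer G"
      if f: "f \<in> forest_stabilizer G" for f
    proof -
      have "f \<in> graph_auts ?F" using f S by auto
      moreover from this have b: "f \<in> Bij ?V" using inB by auto
      ultimately have "(\<lambda>x\<in>?V. inv_into ?V f x) \<in> graph_auts ?F"
        using B.m_inv_closed[of f] by (simp add: inv_BijGroup)
      moreover have "inv_into ?V f v = v" if "v \<in> intersection_verts G" for v
        using Bij_inv_f[OF b, of v] f that I by (auto simp: forest_stabilizer_def)
      ultimately show ?thesis
        using I by (auto simp: forest_stabilizer_def Aut_def)
    qed
  qed
  then show ?thesis
    unfolding Aut_def
    by (rule group.subgroup_incl[OF group_BijGroup _ subgroup_graph_auts S])
qed

lemma H1_pullback_compose: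
  assumes "pair_graph G" "g \<in> graph_auts G" "h \<in> graph_auts G" "X \<in> H1 G"
  shows "H1_pullback G (compose (pverts G) g h) X = H1_pullback G h (H1_pullback G g X)"
proof -
  interpret pair_graph G by fact
  have gB: "g \<in> Bij (pverts G)" and hB: "h \<in> Bij (pverts G)"
    using assms(2,3) by (auto simp: graph_auts_def)
  have gh: "compose (pverts G) g h \<in> graph_auts G"
    using subgroup.m_closed[OF subgroup_graph_auts assms(2,3)] gB hB
    by (simp add: BijGroup_def)
  obtain f where f: "f \<in> Omega1 G" "X = H1_class G f" using assms(4) by (auto simp: H1_def)
  have "pullback G (compose (pverts G) g h) f = pullback G h (pullback G g f)"
    using graph_auts_arc[OF pair_wf_digraph assms(3)] in_arcsD1 in_arcsD2
    by (auto simp: pullback_def compose_def fun_eq_iff)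
  then show ?thesis
    using f gh assms by (simp add: H1_pullback_class pair_wf_digraph pullback_Omega1)
qed

lemma H1_pullback_one:
  assumes "pair_graph G" "X \<in> H1 G"
  shows "H1_pullback G (\<lambda>x\<in>pverts G. x) X = X"
proof -
  interpret pair_graph G by fact
  have i: "(\<lambda>x\<in>pverts G. x) \<in> graph_auts G" by (simp add: graph_auts_def id_Bij)
  obtain f where f: "f \<in> Omega1 G" "X = H1_class G f" using assms(2) by (auto simp: H1_def)
  have "pullback G (\<lambda>x\<in>pverts G. x) f = f"
    using f(1) in_arcsD1 in_arcsD2 by (auto simp: pullback_def Omega1_def fun_eq_iff)
  then show ?thesis using f i by (simp add: H1_pullback_class pair_wf_digraph)
qed

lemma H1_pullback_closed:
  assumes "pair_graph G" "g \<in> graph_auts G" "X \<in> H1 G"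
  shows "H1_pullback G g X \<in> H1 G"
proof -
  interpret pair_graph G by fact
  show ?thesis
    using assms by (auto simp: H1_def H1_pullback_class pair_wf_digraph pullback_Omega1)
qed

lemma H1_pullback_GL:
  assumes G: "pair_graph G" and g: "g \<in> graph_auts G"
  shows "H1_pullback G g \<in> carrier (GL_H1 G)"
proof -
  interpret pair_graph G by fact
  let ?V = "pverts G"
  let ?i = "\<lambda>x\<in>?V. inv_into ?V g x"
  have b: "g \<in> Bij ?V" using g by (simp add: graph_auts_def)
  have i: "?i \<in> graph_auts G"
    using subgroup.m_inv_closed[OF subgroup_graph_auts g] b by (simp add: inv_BijGroup)
  have gi: "compose ?V g ?i = (\<lambda>x\<in>?V. x)"
    using b Bij_f_inv by (auto simp: compose_def fun_eq_iff)
  have ig: "compose ?V ?i g = (\<lambda>x\<in>?V. x)"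
    using b Bij_compose_restrict_eq by blast
  have "bij_betw (H1_pullback G g) (H1 G) (H1 G)"
    by (rule bij_betw_byWitness[where f' = "H1_pullback G ?i"])
      (use H1_pullback_compose[OF G g i] H1_pullback_compose[OF G i g] gi ig
        H1_pullback_one[OF G] H1_pullback_closed[OF G] g i in auto)
  then have B: "H1_pullback G g \<in> Bij (H1 G)" by (simp add: Bij_def H1_pullback_def)
  show ?thesis
    using B g
    by (auto simp: GL_H1_def H1_def H1_add_class H1_scale_class H1_pullback_class
        pair_wf_digraph Omega1_add Omega1_scale pullback_add pullback_scale)
qed

lemma phi1_hom:
  assumes G: "pair_graph G" shows "group_hom (Aut G) (GL_H1 G) (phi1 G)"
proof -
  interpret L: group "GL_H1 G" by (rule group_GL_H1)
  have "phi1 G (g \<otimes>\<^bsub>Aut G\<^esub> h) = phi1 G g \<otimes>\<^bsub>GL_H1 G\<^esub> phi1 G h"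
    if g: "g \<in> graph_auts G" and h: "h \<in> graph_auts G" for g h
  proof -
    have Bs: "g \<in> Bij (pverts G)" "h \<in> Bij (pverts G)"
      using g h by (auto simp: graph_auts_def)
    have P: "H1_pullback G g \<in> Bij (H1 G)" "H1_pullback G h \<in> Bij (H1 G)"
      using H1_pullback_GL[OF G g] H1_pullback_GL[OF G h] by (simp_all add: GL_H1_def)
    have "H1_pullback G (g \<otimes>\<^bsub>Aut G\<^esub> h) = H1_pullback G h \<otimes>\<^bsub>GL_H1 G\<^esub> H1_pullback G g"
    proof (rule extensionalityI[of _ "H1 G"])
      show "H1_pullback G (g \<otimes>\<^bsub>Aut G\<^esub> h) \<in> extensional (H1 G)"
        by (simp add: H1_pullback_def)
      show "H1_pullback G h \<otimes>\<^bsub>GL_H1 G\<^esub> H1_pullback G g \<in> extensional (H1 G)"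
        using P by (simp add: GL_H1_def BijGroup_def)
      fix X assume X: "X \<in> H1 G"
      have "g \<otimes>\<^bsub>Aut G\<^esub> h = compose (pverts G) g h"
        using Bs by (simp add: Aut_def BijGroup_def)
      moreover have "H1_pullback G h \<otimes>\<^bsub>GL_H1 G\<^esub> H1_pullback G g
          = compose (H1 G) (H1_pullback G h) (H1_pullback G g)"
        using P by (simp add: GL_H1_def BijGroup_def)
      ultimately show "H1_pullback G (g \<otimes>\<^bsub>Aut G\<^esub> h) X
          = (H1_pullback G h \<otimes>\<^bsub>GL_H1 G\<^esub> H1_pullback G g) X"
        using H1_pullback_compose[OF G g h X] X by (simp only: compose_eq)
    qed
    then show ?thesis
      using L.inv_mult_group[OF H1_pullback_GL[OF G h] H1_pullback_GL[OF G g]]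
      by (simp only: phi1_def)
  qed
  moreover have "phi1 G g \<in> carrier (GL_H1 G)" if "g \<in> graph_auts G" for g
    unfolding phi1_def using H1_pullback_GL[OF G that] by (rule L.inv_closed)
  moreover have "carrier (Aut G) = graph_auts G" by (simp add: Aut_def)
  ultimately have "phi1 G \<in> hom (Aut G) (GL_H1 G)"
    by (intro homI) blast+
  then show ?thesis
    by (simp add: group_hom_def group_hom_axioms_def group_Aut group_GL_H1)
qed

end

theory Submission
  imports Defs "HOL-Combinatorics.Cycles"
begin

text \<open>
  An automorphism is in the kernel iff it fixes the core, the unpruned vertices, pointwise; restricting
  such an automorphism to the forest part loses nothing, and every element of the stabilizer extends by
  the identity.

  If \<open>g\<close> fixes the core, then \<open>g\<^sup>* f - f\<close> vanishes on the core, and a potential for it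
  is extended over the pruned vertices one leaf at a time.

  Conversely let \<open>g\<^sup>* f - f\<close> be a gradient for every \<open>f\<close>.  A gradient without divergence
  is zero, so \<open>g\<close> preserves all circulations.  If an arc \<open>e\<close> carrying a circulation moved,
  then \<open>\<delta>\<^sub>e - \<delta>\<^bsub>ge\<^esub> = Du\<close> for a potential \<open>u\<close> with exactly two values, whose sum
  along \<open>g\<close>-orbits is constant.  As \<open>b\<^sub>1 \<ge> 2\<close>, some nonzero circulation vanishes on \<open>e\<close>;
  it splits along the level sets of \<open>u\<close> into invariant circulations, so \<open>u\<close> is constant on the
  orbit of any vertex of its support, which is absurd.  Hence \<open>g\<close> fixes all vertices on cycles.  The
  same argument, with flows whose sources and sinks lie on cycles instead of circulations, applies to the
  remaining arcs of the core.
\<close>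

section \<open>Circulations\<close>

text \<open>The net outflow at \<open>x\<close>. Summing over all vertices instead of the neighbours
  is harmless because members of \<open>Omega1 G\<close> vanish off the arcs, and it makes
  reindexing by an automorphism easy.\<close>

definition divergence :: "'v pair_pre_digraph \<Rightarrow> ('v \<times> 'v \<Rightarrow> real) \<Rightarrow> 'v \<Rightarrow> real"
  where "divergence G y x = (\<Sum>w\<in>pverts G. y (x, w))"

definition circulations :: "'v pair_pre_digraph \<Rightarrow> ('v \<times> 'v \<Rightarrow> real) set"
  where "circulations G = {z \<in> Omega1 G. \<forall>x\<in>pverts G. divergence G z x = 0}"

text \<open>The unit flow along \<open>e\<close>, written \<open>\<delta>\<^sub>e\<close> in the
  overview; the second term makes it antisymmetric.\<close>

definition arc_form :: "'v \<times> 'v \<Rightarrow> 'v \<times> 'v \<Rightarrow> real"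
  where "arc_form e a = of_bool (a = e) - of_bool (prod.swap a = e)"

lemma divergence_add: "divergence G (y + z) x = divergence G y x + divergence G z x"
  by (simp add: divergence_def sum.distrib)

lemma divergence_scale: "divergence G (c *\<^sub>R y) x = c * divergence G y x"
  by (simp add: divergence_def scaleR_fun_def sum_distrib_left)

lemma divergence_diff: "divergence G (y - z) x = divergence G y x - divergence G z x"
  by (simp add: divergence_def sum_subtractf)

lemma Omega1_diff: "f \<in> Omega1 G \<Longrightarrow> h \<in> Omega1 G \<Longrightarrow> f - h \<in> Omega1 G"
  using Omega1_add[of f G "(-1) *\<^sub>R h"] Omega1_scale[of h G "-1"] by simp

lemma (in pair_graph) arc_sym: "(v, w) \<in> parcs G \<Longrightarrow> (w, v) \<in> parcs G"
  using arcs_symmetric by blast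

lemma (in pair_graph) Omega1_antisym:
  assumes "f \<in> Omega1 G" shows "f (w, v) = - f (v, w)"
proof (cases "(v, w) \<in> parcs G")
  case True
  then show ?thesis using Omega1D(2)[OF assms, of v w] by simp
next
  case False
  then have "(w, v) \<notin> parcs G" using arc_sym by blast
  with False show ?thesis using Omega1D(1)[OF assms] by simp
qed

lemma (in pair_graph) arc_form_Omega1:
  assumes "e \<in> parcs G" shows "arc_form e \<in> Omega1 G"
proof (rule Omega1I)
  show "arc_form e a = 0" if "a \<notin> parcs G" for a
  proof -
    have "prod.swap a \<notin> parcs G" using that arc_sym by (cases a) fastforce
    then show ?thesis using that assms by (auto simp: arc_form_def)
  qed
qed (simp add: arc_form_def)

lemma divergence_arc_form:
  assumes "finite (pverts G)" "v \<in> pverts G" "w \<in> pverts G"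
  shows "divergence G (arc_form (v, w)) x = of_bool (x = v) - of_bool (x = w)"
  using assms
  by (simp add: divergence_def arc_form_def sum_subtractf of_bool_conj
      sum_distrib_left[symmetric] sum_distrib_right[symmetric] flip: mult.commute)

text \<open>Summation by parts: exchanging the two sums and using antisymmetry turns the terms with
  \<open>\<phi> w\<close> into a second copy of those with \<open>\<phi> v\<close>, hence the factor
  2.\<close>

lemma (in pair_graph) sum_gradient_eq_divergence:
  assumes "y \<in> Omega1 G"
  shows "(\<Sum>v\<in>pverts G. \<Sum>w\<in>pverts G. (\<phi> w - \<phi> v) * y (v, w))
    = - 2 * (\<Sum>x\<in>pverts G. \<phi> x * divergence G y x)"
proof -
  have "(\<Sum>v\<in>pverts G. \<Sum>w\<in>pverts G. \<phi> w * y (v, w))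
      = (\<Sum>w\<in>pverts G. \<Sum>v\<in>pverts G. \<phi> w * y (v, w))"
    by (rule sum.swap)
  also have "\<dots> = - (\<Sum>x\<in>pverts G. \<phi> x * divergence G y x)"
    unfolding divergence_def sum_distrib_left sum_negf[symmetric]
    by (intro sum.cong refl) (metis Omega1_antisym[OF assms] mult_minus_right)
  finally show ?thesis
    by (simp add: left_diff_distrib sum_subtractf divergence_def sum_distrib_left)
qed

text \<open>Gradients are orthogonal to circulations, so a form that is both is orthogonal to itself
  and has a vanishing sum of squares.\<close>

lemma (in pair_graph) gradient_circulation_zero:
  assumes "coboundary G u \<in> circulations G" shows "coboundary G u = 0"
proof
  let ?D = "coboundary G u"
  have D: "?D \<in> Omega1 G" "\<And>x. x \<in> pverts G \<Longrightarrow> divergence G ?D x = 0"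
    using assms by (auto simp: circulations_def)
  have "(\<Sum>v\<in>pverts G. \<Sum>w\<in>pverts G. (?D (v, w))\<^sup>2)
      = (\<Sum>v\<in>pverts G. \<Sum>w\<in>pverts G. (u w - u v) * ?D (v, w))"
    by (intro sum.cong refl) (auto simp: coboundary_def power2_eq_square)
  also have "\<dots> = 0" by (simp add: sum_gradient_eq_divergence[OF D(1)] D(2))
  finally have "\<forall>v\<in>pverts G. \<forall>w\<in>pverts G. ?D (v, w) = 0"
    using pair_finite_verts by (simp add: sum_nonneg_eq_0_iff sum_nonneg)
  then have "?D (v, w) = 0" for v w
    using in_arcsD1 in_arcsD2 by (cases "(v, w) \<in> parcs G") (blast, simp add: coboundary_def)
  then show "?D a = 0 a" for a by (cases a) simp
qed

section \<open>Cycles as circulations, and the Betti number\<close>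

lemma cycle_vector_Cons: "cycle_vector (e # p) = cycle_vector p + arc_form e"
proof
  show "cycle_vector (e # p) q = (cycle_vector p + arc_form e) q" for q
  proof -
    obtain v w where q: "q = (v, w)" by fastforce
    have 1: "real (count_list (e # p) r) = real (count_list p r) + of_bool (r = e)" for r
      by (cases "r = e") simp_all
    show ?thesis
      unfolding q cycle_vector_def arc_form_def prod.case plus_fun_apply 1 prod.swap_def
      by simp
  qed
qed

text \<open>A walk leaves each inner vertex as often as it enters it. Distinct ends are allowed so
  that the induction can drop the first arc; closed walks are the case \<open>a = b\<close>.\<close>

lemma divergence_awalk:
  assumes "finite (pverts G)" "pair_wf_digraph G" "set p \<subseteq> parcs G" "pcas a p b"
  shows "divergence G (cycle_vector p) x = of_bool (x = a) - of_bool (x = b)"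
  using assms(3,4)
proof (induction p arbitrary: a)
  case Nil
  then show ?case by (simp add: divergence_def cycle_vector_def)
next
  case (Cons e p)
  interpret pair_wf_digraph G by fact
  obtain c where e: "e = (a, c)" using Cons.prems by (cases e) auto
  have ac: "a \<in> pverts G" "c \<in> pverts G" using Cons.prems e in_arcsD1 in_arcsD2 by auto
  have "cycle_vector (e # p) = cycle_vector p + arc_form e" by (rule cycle_vector_Cons)
  moreover have "divergence G (arc_form e) x = of_bool (x = a) - of_bool (x = c)"
    unfolding e using divergence_arc_form[OF assms(1) ac] .
  moreover have "divergence G (cycle_vector p) x
      = of_bool (x = c) - of_bool (x = b)"
    using Cons e by auto
  ultimately show ?case by (simp only: divergence_add)
qed

lemma (in pair_graph) cycle_vector_circulation:
  assumes "cycle p" shows "cycle_vector p \<in> circulations G"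
proof -
  obtain a where a: "set p \<subseteq> parcs G" "pcas a p a"
    using assms by (auto simp: cycle_def awalk_def)
  have "divergence G (cycle_vector p) x = 0" for x
    using divergence_awalk[OF pair_finite_verts pair_wf_digraph a] by simp
  moreover have "cycle_vector p \<in> Omega1 G"
  proof (rule Omega1I)
    show "cycle_vector p x = 0" if "x \<notin> parcs G" for x
    proof -
      obtain v w where x: "x = (v, w)" by fastforce
      then have "(v, w) \<notin> set p" "(w, v) \<notin> set p" using that a(1) arc_sym by auto
      then show ?thesis by (simp add: x cycle_vector_def count_notin)
    qed
  qed (simp add: cycle_vector_def)
  ultimately show ?thesis by (simp add: circulations_def)
qed

lemma circulations_scale: "z \<in> circulations G \<Longrightarrow> c *\<^sub>R z \<in> circulations G"
  by (auto simp: circulations_def Omega1_scale divergence_scale)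

lemma circulations_diff: "y \<in> circulations G \<Longrightarrow> z \<in> circulations G \<Longrightarrow> y - z \<in> circulations G"
  by (auto simp: circulations_def Omega1_diff divergence_diff)

text \<open>Two independent circulations have a nonzero combination that cancels at
  \<open>e\<close>. The bound on the Betti number enters the proof through this lemma alone.\<close>

lemma (in pair_graph) circulation_vanishing_at:
  assumes "betti1 G \<ge> 2"
  obtains z where "z \<in> circulations G" "z \<noteq> 0" "z e = 0"
proof -
  let ?B = "{cycle_vector p | p. cycle p \<and> 3 \<le> length p}"
  have B: "?B \<subseteq> circulations G" using cycle_vector_circulation by auto
  \<comment> \<open>A single vector spans at most one dimension. Taking \<open>z = 0\<close> yields
    a nonzero cycle vector \<open>z0\<close>, and then \<open>z = z0\<close> yields one independent
    of it.\<close>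
  have notin: "\<not> ?B \<subseteq> span {z}" for z
    using dim_le_card[of ?B "{z}"] assms by (auto simp: betti1_def)
  from notin[of 0] obtain z0 where z0: "z0 \<in> ?B" "z0 \<noteq> 0" by auto
  from notin[of z0] obtain z1 where z1: "z1 \<in> ?B" "z1 \<notin> span {z0}" by blast
  show ?thesis
  proof (cases "z0 e = 0")
    case True
    then show ?thesis using that z0 B by blast
  next
    case False
    let ?z = "z1 - (z1 e / z0 e) *\<^sub>R z0"
    have "?z \<in> circulations G"
      using z0(1) z1(1) B by (blast intro: circulations_diff circulations_scale)
    moreover have "?z \<noteq> 0" using z1(2) by (auto simp: span_singleton)
    moreover have "?z e = 0" using False by (simp add: scaleR_fun_def)
    ultimately show ?thesis using that by blast
  qed
qed

text \<open>Provides one period common to all orbits, over which orbit sums are taken later.\<close>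

lemma bij_betw_funpow_eq_id:
  assumes "finite S" "bij_betw f S S"
  obtains n :: nat where "0 < n" "\<And>x. x \<in> S \<Longrightarrow> (f ^^ n) x = x"
proof -
  \<comment> \<open>Permutations are total functions that fix everything outside \<open>S\<close>,
    whereas \<open>f\<close> is arbitrary there.\<close>
  let ?p = "\<lambda>x. if x \<in> S then f x else x"
  have "bij_betw ?p S S" using assms(2) by (simp cong: bij_betw_cong)
  then have "?p permutes S" by (rule bij_imp_permutes) simp
  then have "permutation ?p" using assms(1) permutation_permutes by blast
  then obtain n where n: "?p ^^ n = id" "0 < n" using permutation_is_nilpotent by blast
  have "(f ^^ k) x = (?p ^^ k) x \<and> (f ^^ k) x \<in> S" if "x \<in> S" for x k
    using that assms(2) by (induction k) (auto simp: bij_betw_def)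
  then show ?thesis using n that by (metis id_apply)
qed

locale connected_pair_graph = pair_graph +
  assumes conn: "connected (with_proj G)"
begin

text \<open>Connectedness in the form of an induction principle: for symmetric arcs it is strong
  connectedness, so a directed walk carries \<open>P\<close> from \<open>x\<close> to
  \<open>y\<close>.\<close>

lemma arc_closed_imp_all:
  assumes "x \<in> pverts G" "P x" "\<And>v w. (v, w) \<in> parcs G \<Longrightarrow> P v \<Longrightarrow> P w" "y \<in> pverts G"
  shows "P y"
proof -
  have "strongly_connected (with_proj G)"
    using symmetric_connected_imp_strongly_connected[OF sym_arcs conn] .
  then have "x \<rightarrow>\<^sup>*\<^bsub>with_proj G\<^esub> y" using assms(1,4) by (simp add: strongly_connected_def)
  then show ?thesis
    by (induction rule: reachable_induct) (use assms(2,3) in auto)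
qed

end

section \<open>Pruning leaves\<close>

definition remaining :: "'v pair_pre_digraph \<Rightarrow> nat \<Rightarrow> 'v set"
  where "remaining G j = pverts G - (\<Union>i<j. leaf_layer G i)"

abbreviation core_verts :: "'v pair_pre_digraph \<Rightarrow> 'v set"
  where "core_verts G \<equiv> pverts G - pruned G"

text \<open>These are the vertices lying on cycles. Describing them by supports of circulations
  means that no cycle has to be constructed to show membership.\<close>

definition cyclic_verts :: "'v pair_pre_digraph \<Rightarrow> 'v set"
  where "cyclic_verts G = {x. \<exists>z\<in>circulations G. \<exists>w. z (x, w) \<noteq> 0}"

lemma mem_leaves_induce_iff:
  "v \<in> leaves (with_proj G \<restriction> S) \<longleftrightarrow> v \<in> S \<and> card {w \<in> S. (v, w) \<in> parcs G} = 1"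
proof -
  have "out_arcs (with_proj G \<restriction> S) v = Pair v ` {w \<in> S. (v, w) \<in> parcs G}" if "v \<in> S"
    using that by (auto simp: out_arcs_def)
  then show ?thesis
    by (auto simp: leaves_def out_degree_def card_image inj_on_def)
qed

lemma mem_leaf_layer_iff:
  "v \<in> leaf_layer G j \<longleftrightarrow>
    v \<in> remaining G j \<and> card {w \<in> remaining G j. (v, w) \<in> parcs G} = 1"
  unfolding leaf_layer.simps[of G j] remaining_def by (rule mem_leaves_induce_iff)

lemma remaining_0: "remaining G 0 = pverts G"
  by (simp add: remaining_def)

lemma remaining_Suc: "remaining G (Suc j) = remaining G j - leaf_layer G j"
  by (auto simp: remaining_def lessThan_Suc)

lemma core_subset_remaining: "core_verts G \<subseteq> remaining G j"
  by (auto simp: remaining_def pruned_def)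

lemma pruned_subset: "pruned G \<subseteq> pverts G"
proof -
  have "leaf_layer G j \<subseteq> remaining G j" for j by (auto simp: mem_leaf_layer_iff)
  then show ?thesis unfolding pruned_def remaining_def by blast
qed

text \<open>Since \<open>pruned G\<close> is finite, finitely many layers cover it, and any
  \<open>k\<close> beyond their indices will do.\<close>

lemma (in pair_graph) remaining_eventually_core:
  obtains k where "remaining G k = core_verts G"
proof -
  have "finite (pruned G)" using pruned_subset pair_finite_verts by (rule finite_subset)
  then obtain I where I: "finite I" "pruned G \<subseteq> (\<Union>j\<in>I. leaf_layer G j)"
    using finite_subset_Union[of "pruned G" "range (leaf_layer G)"]
    unfolding pruned_def by (metis finite_subset_image order_refl)
  obtain k where "\<forall>i\<in>I. i < k" using I(1) finite_nat_set_iff_bounded by blast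
  then have "pruned G = (\<Union>i<k. leaf_layer G i)" using I(2) unfolding pruned_def by blast
  then show ?thesis using that[of k] by (simp add: remaining_def)
qed

text \<open>Once only the core remains, a vertex with a single core neighbour would be a leaf of the
  next layer, hence pruned.\<close>

lemma (in pair_graph) core_second_neighbour:
  assumes "x \<in> core_verts G" "w \<in> core_verts G" "(x, w) \<in> parcs G"
  obtains w' where "w' \<in> core_verts G" "(x, w') \<in> parcs G" "w' \<noteq> w"
proof -
  obtain k where k: "remaining G k = core_verts G" by (rule remaining_eventually_core)
  let ?N = "{w \<in> core_verts G. (x, w) \<in> parcs G}"
  have "card ?N \<noteq> 1"
    using assms(1) mem_leaf_layer_iff[of x G k] k by (auto simp: pruned_def)
  then have "?N \<noteq> {w}" by auto
  then show ?thesis using that assms by blast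
qed

lemma (in pair_graph) leaf_layer_neighbour_unique:
  assumes "v \<in> leaf_layer G j" "(v, a) \<in> parcs G" "(v, b) \<in> parcs G"
    "a \<in> remaining G j" "b \<in> remaining G j"
  shows "a = b"
proof -
  let ?N = "{w \<in> remaining G j. (v, w) \<in> parcs G}"
  obtain x where "?N = {x}"
    using assms(1) card_1_singletonE unfolding mem_leaf_layer_iff by blast
  moreover have "a \<in> ?N" "b \<in> ?N" using assms(2-5) by auto
  ultimately show ?thesis by simp
qed

text \<open>Flow that enters a leaf cannot leave it again, so circulations live on what remains
  after each layer is removed.\<close>

lemma (in pair_graph) circulation_support_remaining:
  assumes z: "z \<in> circulations G" and "z (a, b) \<noteq> 0"
  shows "a \<in> remaining G j \<and> b \<in> remaining G j"
  using assms(2)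
proof (induction j arbitrary: a b)
  case 0
  then have "(a, b) \<in> parcs G" using z Omega1D(1)[of z G "(a, b)"] by (auto simp: circulations_def)
  then show ?case by (auto simp: remaining_0 in_arcsD1 in_arcsD2)
next
  case (Suc j)
  have z1: "z \<in> Omega1 G" using z by (simp add: circulations_def)
  have "a \<notin> leaf_layer G j" if ab: "z (a, b) \<noteq> 0" for a b
  proof
    assume a: "a \<in> leaf_layer G j"
    have arc: "(a, c) \<in> parcs G" if "z (a, c) \<noteq> 0" for c using Omega1D(1)[OF z1] that by blast
    \<comment> \<open>By the induction hypothesis an arc carrying flow leads to a remaining vertex,
      and the leaf \<open>a\<close> has only one such neighbour. So its divergence is the single
      value \<open>z (a, b)\<close>.\<close>
    have "z (a, c) = 0" if "c \<noteq> b" for c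
      using leaf_layer_neighbour_unique[OF a arc arc, of c b] Suc.IH[of a c] Suc.IH[of a b] ab that
      by blast
    then have "divergence G z a = (\<Sum>c\<in>pverts G. if c = b then z (a, b) else 0)"
      unfolding divergence_def by (intro sum.cong) auto
    also have "\<dots> = z (a, b)" using arc[OF ab] in_arcsD2 pair_finite_verts by simp
    finally show False
      using z ab arc[OF ab] in_arcsD1[of a b] by (auto simp: circulations_def)
  qed
  from this[of a b] this[of b a] show ?case
    using Suc Omega1_antisym[OF z1, of a b] by (simp add: remaining_Suc)
qed

lemma (in pair_graph) cyclic_verts_subset_core: "cyclic_verts G \<subseteq> core_verts G"
proof -
  obtain k where "remaining G k = core_verts G" by (rule remaining_eventually_core)
  then show ?thesis
    unfolding cyclic_verts_def using circulation_support_remaining[of _ _ _ k] by blast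
qed

section \<open>Extending potentials from the core to the graph\<close>

text \<open>A vertex with at most one neighbour never obstructs extending a potential.\<close>

lemma (in pair_graph) potential_extend:
  assumes "finite A" "A \<inter> S = {}" "h \<in> Omega1 G"
    and "\<And>v a b. v \<in> A \<Longrightarrow> (v, a) \<in> parcs G \<Longrightarrow> (v, b) \<in> parcs G \<Longrightarrow> a \<in> S \<union> A \<Longrightarrow> b \<in> S \<union> A \<Longrightarrow> a = b"
    and "\<And>a b. (a, b) \<in> parcs G \<Longrightarrow> a \<in> S \<Longrightarrow> b \<in> S \<Longrightarrow> h (a, b) = u b - u a"
  shows "\<exists>u'. (\<forall>x\<in>S. u' x = u x) \<and>
    (\<forall>a b. (a, b) \<in> parcs G \<longrightarrow> a \<in> S \<union> A \<longrightarrow> b \<in> S \<union> A \<longrightarrow> h (a, b) = u' b - u' a)"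
  using assms(1,2,4)
proof (induction A)
  case empty
  then show ?case using assms(5) by auto
next
  case (insert v A)
  have "\<exists>u'. (\<forall>x\<in>S. u' x = u x) \<and>
    (\<forall>a b. (a, b) \<in> parcs G \<longrightarrow> a \<in> S \<union> A \<longrightarrow> b \<in> S \<union> A \<longrightarrow> h (a, b) = u' b - u' a)"
    using insert.prems by (intro insert.IH) blast+
  then obtain u' where u': "\<And>x. x \<in> S \<Longrightarrow> u' x = u x"
    "\<And>a b. (a, b) \<in> parcs G \<Longrightarrow> a \<in> S \<union> A \<Longrightarrow> b \<in> S \<union> A \<Longrightarrow> h (a, b) = u' b - u' a" by blast
  have v: "v \<notin> S \<union> A" using insert by auto
  have uniq: "\<And>a b. (v, a) \<in> parcs G \<Longrightarrow> (v, b) \<in> parcs G \<Longrightarrow> a \<in> S \<union> A \<Longrightarrow> b \<in> S \<union> A \<Longrightarrow> a = b"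
    using insert.prems(2) by blast
  have noloop: "(v, v) \<notin> parcs G" using pair_no_loops[of "(v, v)"] by auto
  \<comment> \<open>The value of the potential at \<open>v\<close>: dictated by the one neighbour in
    \<open>S \<union> A\<close> if it exists, arbitrary otherwise.\<close>
  obtain t where t: "\<And>q. (v, q) \<in> parcs G \<Longrightarrow> q \<in> S \<union> A \<Longrightarrow> h (v, q) = u' q - t"
  proof (cases "\<exists>q\<in>S \<union> A. (v, q) \<in> parcs G")
    case True
    then obtain q where "q \<in> S \<union> A" "(v, q) \<in> parcs G" by blast
    then have "h (v, r) = u' r - (u' q - h (v, q))" if "(v, r) \<in> parcs G" "r \<in> S \<union> A" for r
      using uniq[of r q] that by simp
    then show ?thesis by (rule that)
  qed (use that in blast)
  let ?u = "u'(v := t)"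
  have "h (a, b) = ?u b - ?u a"
    if ab: "(a, b) \<in> parcs G" "a \<in> S \<union> insert v A" "b \<in> S \<union> insert v A" for a b
  proof -
    consider "a = v" "b \<noteq> v" | "b = v" "a \<noteq> v" | "a \<noteq> v" "b \<noteq> v" using ab(1) noloop by blast
    then show ?thesis
    proof cases
      case 1
      then show ?thesis using t ab by auto
    next
      case 2
      then show ?thesis using t[of a] ab arc_sym[OF ab(1)] Omega1_antisym[OF assms(3), of v a] by auto
    next
      case 3
      then show ?thesis using u'(2) ab by auto
    qed
  qed
  moreover have "\<forall>x\<in>S. ?u x = u x" using u'(1) v by auto
  ultimately show ?case by blast
qed

text \<open>The layers are put back in reverse order, each of their vertices having a single
  neighbour among those present. Hence being a gradient is decided on the core.\<close>

lemma (in pair_graph) potential_extend_core: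
  assumes h: "h \<in> Omega1 G"
    and "\<And>a b. (a, b) \<in> parcs G \<Longrightarrow> a \<in> core_verts G \<Longrightarrow> b \<in> core_verts G \<Longrightarrow> h (a, b) = u b - u a"
  obtains u' where "\<And>x. x \<in> core_verts G \<Longrightarrow> u' x = u x" "h = coboundary G u'"
proof -
  obtain k where k: "remaining G k = core_verts G" by (rule remaining_eventually_core)
  have "\<exists>u'. (\<forall>x\<in>core_verts G. u' x = u x) \<and> (\<forall>a b. (a, b) \<in> parcs G \<longrightarrow>
    a \<in> remaining G j \<longrightarrow> b \<in> remaining G j \<longrightarrow> h (a, b) = u' b - u' a)" if "j \<le> k" for j
    using that
  proof (induction rule: inc_induct)
    case base
    then show ?case using assms(2) k by auto
  next
    case (step j)
    then obtain u1 where u1: "\<And>x. x \<in> core_verts G \<Longrightarrow> u1 x = u x"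
      "\<And>a b. (a, b) \<in> parcs G \<Longrightarrow> a \<in> remaining G (Suc j) \<Longrightarrow> b \<in> remaining G (Suc j)
        \<Longrightarrow> h (a, b) = u1 b - u1 a" by blast
    have Rj: "remaining G (Suc j) \<union> leaf_layer G j = remaining G j"
      by (auto simp: remaining_Suc mem_leaf_layer_iff)
    have "leaf_layer G j \<subseteq> pverts G" using pruned_subset[of G] unfolding pruned_def by blast
    then have "finite (leaf_layer G j)" using pair_finite_verts finite_subset by blast
    moreover have "leaf_layer G j \<inter> remaining G (Suc j) = {}" by (auto simp: remaining_Suc)
    ultimately have "\<exists>u2. (\<forall>x\<in>remaining G (Suc j). u2 x = u1 x) \<and> (\<forall>a b. (a, b) \<in> parcs G \<longrightarrow>
      a \<in> remaining G (Suc j) \<union> leaf_layer G j \<longrightarrow> b \<in> remaining G (Suc j) \<union> leaf_layer G j \<longrightarrow>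
      h (a, b) = u2 b - u2 a)"
      by (rule potential_extend[OF _ _ h])
        (simp only: Rj, rule leaf_layer_neighbour_unique, assumption+, rule u1(2))
    then obtain u2 where u2: "\<forall>x\<in>remaining G (Suc j). u2 x = u1 x"
      "\<forall>a b. (a, b) \<in> parcs G \<longrightarrow> a \<in> remaining G j \<longrightarrow> b \<in> remaining G j \<longrightarrow> h (a, b) = u2 b - u2 a"
      unfolding Rj by blast
    moreover have "\<forall>x\<in>core_verts G. u2 x = u x"
      using u2(1) u1(1) core_subset_remaining[of G "Suc j"] by auto
    ultimately show ?case by blast
  qed
  from this[of 0] obtain u' where u': "\<forall>x\<in>core_verts G. u' x = u x"
    "\<And>a b. (a, b) \<in> parcs G \<Longrightarrow> a \<in> pverts G \<Longrightarrow> b \<in> pverts G \<Longrightarrow> h (a, b) = u' b - u' a"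
    by (auto simp: remaining_0)
  have "h (a, b) = coboundary G u' (a, b)" for a b
    using u'(2)[of a b] in_arcsD1[of a b] in_arcsD2[of a b] Omega1D(1)[OF h, of "(a, b)"]
    by (simp add: coboundary_def)
  then have "h = coboundary G u'" by auto
  then show ?thesis using that u'(1) by blast
qed

text \<open>If \<open>x\<close> were isolated in the core, its indicator would be a potential of the
  zero form there and would extend to all of \<open>G\<close>. By connectedness such a potential is
  constant, yet it separates \<open>x\<close> from \<open>y\<close>.\<close>

lemma (in connected_pair_graph) core_neighbour_exists:
  assumes "x \<in> core_verts G" "y \<in> core_verts G" "x \<noteq> y"
  obtains w where "w \<in> core_verts G" "(x, w) \<in> parcs G"
proof (rule ccontr)
  note obt = that
  assume "\<not> thesis"
  then have iso: "(x, w) \<notin> parcs G" if "w \<in> core_verts G" for w using that obt by blast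
  let ?u = "\<lambda>v. of_bool (v = x) :: real"
  have "0 = ?u b - ?u a" if "(a, b) \<in> parcs G" "a \<in> core_verts G" "b \<in> core_verts G" for a b
    using iso[of b] iso[of a] that arc_sym[of a b] by auto
  moreover have "0 \<in> Omega1 G" by (rule Omega1I) simp_all
  ultimately obtain u where u: "\<And>v. v \<in> core_verts G \<Longrightarrow> u v = ?u v" "0 = coboundary G u"
    using potential_extend_core[of 0 ?u] by auto
  have "u b = u a" if "(a, b) \<in> parcs G" for a b
    using fun_cong[OF u(2), of "(a, b)"] that by (simp add: coboundary_def)
  then have "u y = u x"
    using arc_closed_imp_all[of x "\<lambda>v. u v = u x" y] assms by auto
  then show False using u(1)[of x] u(1)[of y] assms by auto
qed

section \<open>Flows through core arcs\<close>

text \<open>For a bridge, the component beyond it. Both orientations are deleted because an edge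
  consists of two arcs.\<close>

definition arc_side :: "'v pair_pre_digraph \<Rightarrow> 'v \<times> 'v \<Rightarrow> 'v set"
  where "arc_side G e = {x. (snd e, x) \<in> (parcs G - {e, prod.swap e})\<^sup>*}"

text \<open>Add up \<open>arc_form\<close> along a walk from \<open>a\<close> to \<open>b\<close>
  that avoids \<open>e\<close>; the divergences at inner vertices cancel.\<close>

lemma (in pair_graph) unit_flow_avoiding:
  assumes "(a, b) \<in> (parcs G - {e, prod.swap e})\<^sup>*"
  obtains y where "y \<in> Omega1 G" "y e = 0" "\<And>x. divergence G y x = of_bool (x = a) - of_bool (x = b)"
proof -
  from assms have "\<exists>y\<in>Omega1 G. y e = 0 \<and> (\<forall>x. divergence G y x = of_bool (x = a) - of_bool (x = b))"
  proof (induction rule: rtrancl_induct)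
    case base
    have "0 \<in> Omega1 G" by (rule Omega1I) simp_all
    then show ?case by (intro bexI[of _ 0]) (simp_all add: divergence_def)
  next
    case (step b c)
    then obtain y where y: "y \<in> Omega1 G" "y e = 0"
      "\<And>x. divergence G y x = of_bool (x = a) - of_bool (x = b)" by blast
    have bc: "(b, c) \<in> parcs G" "e \<noteq> (b, c)" "prod.swap e \<noteq> (b, c)" using step.hyps by auto
    have "divergence G (arc_form (b, c)) x = of_bool (x = b) - of_bool (x = c)" for x
      using divergence_arc_form[OF pair_finite_verts] in_arcsD1[OF bc(1)] in_arcsD2[OF bc(1)] .
    then have "divergence G (y + arc_form (b, c)) x = of_bool (x = a) - of_bool (x = c)" for x
      by (simp only: divergence_add y(3))
    moreover have "(y + arc_form (b, c)) e = 0" using y(2) bc by (simp add: arc_form_def)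
    ultimately show ?case
      using Omega1_add[OF y(1) arc_form_Omega1[OF bc(1)]] by blast
  qed
  then show ?thesis using that by blast
qed

text \<open>A way back from \<open>w\<close> to \<open>v\<close> around the edge would close up with
  \<open>(v, w)\<close> to a circulation through \<open>v\<close>.\<close>

lemma (in pair_graph) tail_notin_arc_side:
  assumes "(v, w) \<in> parcs G" "v \<notin> cyclic_verts G"
  shows "v \<notin> arc_side G (v, w)"
proof
  assume "v \<in> arc_side G (v, w)"
  then obtain y where y: "y \<in> Omega1 G" "y (v, w) = 0"
    "\<And>x. divergence G y x = of_bool (x = w) - of_bool (x = v)"
    using unit_flow_avoiding[of w v "(v, w)"] unfolding arc_side_def by auto
  have vw: "v \<in> pverts G" "w \<in> pverts G" "v \<noteq> w"
    using assms(1) in_arcsD1 in_arcsD2 pair_no_loops by fastforce+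
  let ?z = "y + arc_form (v, w)"
  have "divergence G ?z x = 0" for x
    by (simp only: divergence_add y(3) divergence_arc_form[OF pair_finite_verts vw(1,2)])
  then have "?z \<in> circulations G"
    using Omega1_add[OF y(1) arc_form_Omega1[OF assms(1)]] by (simp only: circulations_def) simp
  moreover have "?z (v, w) \<noteq> 0" using y(2) vw(3) by (simp add: arc_form_def)
  ultimately show False using assms(2) unfolding cyclic_verts_def by blast
qed

lemma (in pair_graph) arc_side_subset:
  assumes "w \<in> pverts G" shows "arc_side G (v, w) \<subseteq> pverts G"
proof
  fix x assume "x \<in> arc_side G (v, w)"
  then have "(w, x) \<in> (parcs G - {(v, w), prod.swap (v, w)})\<^sup>*" by (simp add: arc_side_def)
  then show "x \<in> pverts G" by (induction rule: rtrancl_induct) (use assms in_arcsD2 in auto)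
qed

text \<open>Otherwise one could walk on inside the core forever, always into a strictly smaller side.\<close>

lemma (in pair_graph) arc_side_meets_cyclic:
  assumes "(v, w) \<in> parcs G" "v \<in> core_verts G" "w \<in> core_verts G"
  shows "arc_side G (v, w) \<inter> cyclic_verts G \<noteq> {}"
  using assms
proof (induction "card (arc_side G (v, w))" arbitrary: v w rule: less_induct)
  case less
  show ?case
  proof
    assume disj: "arc_side G (v, w) \<inter> cyclic_verts G = {}"
    obtain w' where w': "w' \<in> core_verts G" "(w, w') \<in> parcs G" "w' \<noteq> v"
      using core_second_neighbour[OF less.prems(3,2) arc_sym[OF less.prems(1)]] by blast
    have ne: "v \<noteq> w" "w \<noteq> w'"
      using less.prems(1) w'(2) pair_no_loops by fastforce+
    have w_in: "w \<in> arc_side G (v, w)" by (simp add: arc_side_def)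
    then have w_notin: "w \<notin> arc_side G (w, w')" using disj tail_notin_arc_side[OF w'(2)] by blast
    have "arc_side G (w, w') \<subseteq> arc_side G (v, w)"
    proof
      fix x assume "x \<in> arc_side G (w, w')"
      then have "(w', x) \<in> (parcs G - {(w, w'), prod.swap (w, w')})\<^sup>*" by (simp add: arc_side_def)
      then have "x \<in> arc_side G (w, w') \<and> x \<in> arc_side G (v, w)"
      proof (induction rule: rtrancl_induct)
        case base
        show ?case using w' ne by (auto simp: arc_side_def)
      next
        case (step b c)
        have "c \<in> arc_side G (w, w')"
          using step.hyps by (auto simp: arc_side_def intro: rtrancl_into_rtrancl)
        \<comment> \<open>The walk stays in \<open>arc_side G (w, w')\<close> and so never visits
          \<open>w\<close>; in particular it does not use the edge between \<open>v\<close> and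
          \<open>w\<close>.\<close>
        moreover from this have "b \<noteq> w" "c \<noteq> w" using step.IH w_notin by auto
        then have "c \<in> arc_side G (v, w)"
          using step.hyps step.IH by (auto simp: arc_side_def intro: rtrancl_into_rtrancl)
        ultimately show ?case by blast
      qed
      then show "x \<in> arc_side G (v, w)" by blast
    qed
    moreover from this have "card (arc_side G (w, w')) < card (arc_side G (v, w))"
      using w_in w_notin arc_side_subset[of w v] less.prems(3) pair_finite_verts
      by (intro psubset_card_mono) (auto intro: finite_subset)
    ultimately show False using less.hyps[OF _ w'(2) less.prems(3) w'(1)] disj by blast
  qed
qed

text \<open>Flow from a cyclic vertex \<open>b\<close> to \<open>v\<close>, across
  \<open>(v, w)\<close>, and on to a cyclic vertex \<open>a\<close>. The outer pieces avoid the
  edge, so the value on it stays 1. Such flows replace circulations on arcs that lie on no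
  cycle.\<close>

lemma (in pair_graph) core_arc_flow:
  assumes "(v, w) \<in> parcs G" "v \<in> core_verts G" "w \<in> core_verts G"
  obtains y where "y \<in> Omega1 G" "y (v, w) \<noteq> 0" "\<And>x. x \<notin> cyclic_verts G \<Longrightarrow> divergence G y x = 0"
proof -
  obtain a b where ab: "a \<in> arc_side G (v, w)" "a \<in> cyclic_verts G"
    "b \<in> arc_side G (w, v)" "b \<in> cyclic_verts G"
    using arc_side_meets_cyclic[OF assms] arc_side_meets_cyclic[OF arc_sym[OF assms(1)] assms(3,2)]
    by blast
  obtain y1 where y1: "y1 \<in> Omega1 G" "y1 (v, w) = 0"
    "\<And>x. divergence G y1 x = of_bool (x = w) - of_bool (x = a)"
    using unit_flow_avoiding[of w a "(v, w)"] ab(1) unfolding arc_side_def by auto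
  obtain y2 where y2: "y2 \<in> Omega1 G" "y2 (w, v) = 0"
    "\<And>x. divergence G y2 x = of_bool (x = v) - of_bool (x = b)"
    using unit_flow_avoiding[of v b "(w, v)"] ab(3) unfolding arc_side_def by auto
  have vw: "v \<in> pverts G" "w \<in> pverts G" "v \<noteq> w"
    using assms pair_no_loops by fastforce+
  let ?y = "arc_form (v, w) + y1 - y2"
  have "divergence G ?y x = of_bool (x = b) - of_bool (x = a)" for x
    by (simp only: divergence_add divergence_diff y1(3) y2(3)
        divergence_arc_form[OF pair_finite_verts vw(1,2)])
  then have "divergence G ?y x = 0" if "x \<notin> cyclic_verts G" for x
    using that ab(2,4) by (metis diff_self of_bool_eq(1))
  moreover have "?y \<in> Omega1 G"
    by (intro Omega1_diff Omega1_add arc_form_Omega1 assms(1) y1(1) y2(1))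
  moreover have "?y (v, w) \<noteq> 0"
    using y1(2) y2(2) Omega1_antisym[OF y2(1), of v w] vw(3) by (simp add: arc_form_def)
  ultimately show ?thesis using that by blast
qed

section \<open>Automorphisms acting trivially on cohomology\<close>

locale homologically_trivial = connected_pair_graph +
  fixes g :: "'a \<Rightarrow> 'a"
  assumes aut: "g \<in> graph_auts G"
    and trivial: "f \<in> Omega1 G \<Longrightarrow> \<exists>u. pullback G g f = f + coboundary G u"
begin

section \<open>Invariant flows and orbit sums\<close>

lemma bij: "bij_betw g (pverts G) (pverts G)"
  using aut by (simp add: graph_auts_def Bij_def)

lemma g_vert: "x \<in> pverts G \<Longrightarrow> g x \<in> pverts G"
  using bij by (auto simp: bij_betw_def)

lemma g_eq_iff: "x \<in> pverts G \<Longrightarrow> y \<in> pverts G \<Longrightarrow> g x = g y \<longleftrightarrow> x = y"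
  using bij by (auto simp: bij_betw_def inj_on_eq_iff)

lemma g_arc: "(a, b) \<in> parcs G \<Longrightarrow> (g a, g b) \<in> parcs G"
  using graph_auts_arc[OF pair_wf_digraph aut] .

lemma funpow_vert: "x \<in> pverts G \<Longrightarrow> (g ^^ i) x \<in> pverts G"
  by (induction i) (simp_all add: g_vert)

lemma funpow_arc: "(a, b) \<in> parcs G \<Longrightarrow> ((g ^^ i) a, (g ^^ i) b) \<in> parcs G"
  by (induction i) (simp_all add: g_arc)

lemma divergence_pullback:
  assumes "x \<in> pverts G" "y \<in> Omega1 G"
  shows "divergence G (pullback G g y) x = divergence G y (g x)"
proof -
  have "pullback G g y (x, w) = y (g x, g w)" if "w \<in> pverts G" for w
    using aut assms that Omega1D(1)[OF assms(2), of "(g x, g w)"]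
    by (auto simp: pullback_def graph_auts_def)
  then have "divergence G (pullback G g y) x = (\<Sum>w\<in>pverts G. y (g x, g w))"
    by (simp add: divergence_def)
  also have "\<dots> = divergence G y (g x)"
    unfolding divergence_def by (rule sum.reindex_bij_betw[OF bij])
  finally show ?thesis .
qed

text \<open>The change of \<open>y\<close> under pullback is a gradient because \<open>g\<close>
  acts trivially, and it has no divergence because that of \<open>y\<close> is invariant; so it is
  zero.\<close>

lemma pullback_eq:
  assumes "y \<in> Omega1 G" "\<And>x. x \<in> pverts G \<Longrightarrow> divergence G y (g x) = divergence G y x"
  shows "pullback G g y = y"
proof -
  obtain u where u: "pullback G g y = y + coboundary G u" using trivial[OF assms(1)] by blast
  then have D: "coboundary G u = pullback G g y - y" by simp
  have "pullback G g y \<in> Omega1 G"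
    by (rule pullback_Omega1[OF pair_graph aut assms(1)])
  then have "coboundary G u \<in> circulations G"
    unfolding D circulations_def
    using assms by (simp add: Omega1_diff divergence_diff divergence_pullback)
  from gradient_circulation_zero[OF this] u show ?thesis by simp
qed

lemma pullback_eqD:
  assumes "pullback G g y = y" "(a, b) \<in> parcs G" shows "y (g a, g b) = y (a, b)"
proof -
  have "pullback G g y (a, b) = y (a, b)" by (simp only: assms(1))
  then show ?thesis using assms(2) by (simp add: pullback_def)
qed

lemma circulation_invariant:
  assumes "z \<in> circulations G" shows "pullback G g z = z"
  using assms by (intro pullback_eq) (simp_all add: circulations_def g_vert)

lemma arc_form_image:
  assumes "(v, w) \<in> parcs G" "(a, b) \<in> parcs G"
  shows "arc_form (g v, g w) (g a, g b) = arc_form (v, w) (a, b)"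
  using in_arcsD1[OF assms(1)] in_arcsD2[OF assms(1)] in_arcsD1[OF assms(2)] in_arcsD2[OF assms(2)]
  by (simp add: arc_form_def g_eq_iff)

text \<open>Triviality is applied to the form of the image arc, which pulls back to the form of
  \<open>(v, w)\<close> since \<open>g\<close> is injective.\<close>

lemma shift_potential:
  assumes "(v, w) \<in> parcs G"
  obtains u where
    "\<And>a b. (a, b) \<in> parcs G \<Longrightarrow> u b - u a = arc_form (v, w) (a, b) - arc_form (g v, g w) (a, b)"
proof -
  obtain u where u: "pullback G g (arc_form (g v, g w)) = arc_form (g v, g w) + coboundary G u"
    using trivial[OF arc_form_Omega1[OF g_arc[OF assms]]] by blast
  show ?thesis
  proof
    fix a b assume ab: "(a, b) \<in> parcs G"
    show "u b - u a = arc_form (v, w) (a, b) - arc_form (g v, g w) (a, b)"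
      using fun_cong[OF u, of "(a, b)"] ab arc_form_image[OF assms ab]
      by (simp add: pullback_def coboundary_def)
  qed
qed

text \<open>Across an arc the difference of the two orbit sums telescopes along the orbit of that
  arc, which returns to its start after \<open>n\<close> steps.\<close>

lemma orbit_sum_constant:
  assumes u: "\<And>a b. (a, b) \<in> parcs G \<Longrightarrow> u b - u a = f (g a, g b) - f (a, b)"
    and xy: "x \<in> pverts G" "y \<in> pverts G"
    and n: "\<And>x. x \<in> pverts G \<Longrightarrow> (g ^^ n) x = x"
  shows "(\<Sum>i<n. u ((g ^^ i) x)) = (\<Sum>i<n. u ((g ^^ i) y) :: real)"
proof -
  have "(\<Sum>i<n. u ((g ^^ i) b)) = (\<Sum>i<n. u ((g ^^ i) a))" if ab: "(a, b) \<in> parcs G" for a b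
  proof -
    have "(\<Sum>i<n. u ((g ^^ i) b)) - (\<Sum>i<n. u ((g ^^ i) a))
        = (\<Sum>i<n. f ((g ^^ Suc i) a, (g ^^ Suc i) b) - f ((g ^^ i) a, (g ^^ i) b))"
      unfolding sum_subtractf[symmetric] using u[OF funpow_arc[OF ab]] by simp
    also have "\<dots> = f ((g ^^ n) a, (g ^^ n) b) - f ((g ^^ 0) a, (g ^^ 0) b)"
      by (rule sum_lessThan_telescope)
    also have "\<dots> = 0" using n in_arcsD1[OF ab] in_arcsD2[OF ab] by simp
    finally show ?thesis by simp
  qed
  then show ?thesis
    using arc_closed_imp_all[of x "\<lambda>b. (\<Sum>i<n. u ((g ^^ i) b)) = (\<Sum>i<n. u ((g ^^ i) x))" y] xy
    by auto
qed

text \<open>If \<open>(v, w)\<close> moves, then the flow forces \<open>u\<close> to take exactly two values, \<open>\<alpha>\<close> and \<open>\<alpha> + 1\<close>;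
  then a point where \<open>u\<close> is constant along the orbit contradicts the constancy of orbit sums.\<close>

lemma arc_fixed:
  assumes vw: "(v, w) \<in> parcs G"
    and y: "y \<in> Omega1 G" "pullback G g y = y" "y (v, w) \<noteq> 0"
    and u: "\<And>a b. (a, b) \<in> parcs G \<Longrightarrow>
      u b - u a = arc_form (v, w) (a, b) - arc_form (g v, g w) (a, b)"
    and x0: "x0 \<in> pverts G" "\<And>i. u ((g ^^ i) x0) = u x0"
    and div: "\<And>x. x \<in> pverts G \<Longrightarrow> divergence G y x \<noteq> 0 \<Longrightarrow> u x = u x0"
  shows "g v = v \<and> g w = w"
proof (rule ccontr)
  assume "\<not> ?thesis"
  then have ne: "(g v, g w) \<noteq> (v, w)" by simp
  have t: "y (g v, g w) = y (v, w)" by (rule pullback_eqD[OF y(2) vw])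
  \<comment> \<open>Reversing the arc would change the sign of the invariant nonzero value of
    \<open>y\<close>.\<close>
  have ne': "(g v, g w) \<noteq> (w, v)" using t y(3) Omega1_antisym[OF y(1), of w v] by auto
  have loops: "v \<noteq> w" "g v \<noteq> g w" using vw g_arc[OF vw] pair_no_loops by fastforce+
  have V: "v \<in> pverts G" "w \<in> pverts G" "g v \<in> pverts G" "g w \<in> pverts G"
    using in_arcsD1[OF vw] in_arcsD2[OF vw] g_vert by auto
  define \<alpha> where "\<alpha> = u v"
  define \<beta> where "\<beta> = u (g w)"
  \<comment> \<open>The potential rises by 1 along \<open>(v, w)\<close>, drops by 1 along the image
    arc, and is constant along all arcs other than these two and their reversals.\<close>
  have uw: "u w = \<alpha> + 1" and ugv: "u (g v) = \<beta> + 1"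
    using u[OF vw] u[OF g_arc[OF vw]] ne ne' loops
    by (auto simp: arc_form_def \<alpha>_def \<beta>_def)
  have other: "u b = u a"
    if "(a, b) \<in> parcs G" "(a, b) \<notin> {(v, w), (w, v), (g v, g w), (g w, g v)}" for a b
    using u[OF that(1)] that(2) by (auto simp: arc_form_def)
  \<comment> \<open>The indicator of the level \<open>\<alpha>\<close>, shifted by a constant so
    that it vanishes at \<open>u x0\<close>, hence wherever \<open>y\<close> has divergence.
    Summation by parts against \<open>y\<close> then gives 0.\<close>
  define \<phi> :: "real \<Rightarrow> real" where "\<phi> t = of_bool (t = \<alpha>) - of_bool (u x0 = \<alpha>)" for t
  define d1 where "d1 = (\<phi> (u w) - \<phi> (u v)) * y (v, w)"
  define d2 where "d2 = (\<phi> (u (g w)) - \<phi> (u (g v))) * y (v, w)"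
  \<comment> \<open>Only the two arcs and their reversals contribute; reversing an arc flips both
    factors, so each product occurs twice.\<close>
  have pt: "(\<phi> (u b) - \<phi> (u a)) * y (a, b)
      = (if b = w then if a = v then d1 else 0 else 0) + (if b = v then if a = w then d1 else 0 else 0)
        + (if b = g w then if a = g v then d2 else 0 else 0)
        + (if b = g v then if a = g w then d2 else 0 else 0)"
    for a b
  proof -
    consider "(a, b) = (v, w)" | "(a, b) = (w, v)" | "(a, b) = (g v, g w)" | "(a, b) = (g w, g v)"
      | "(a, b) \<notin> {(v, w), (w, v), (g v, g w), (g w, g v)}" by blast
    then show ?thesis
    proof cases
      case 1
      then show ?thesis using ne ne' loops by (auto simp: d1_def)
    next
      case 2
      then show ?thesis using ne ne' loops Omega1_antisym[OF y(1), of w v]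
        by (auto simp: d1_def algebra_simps)
    next
      case 3
      then show ?thesis using ne ne' loops t by (auto simp: d2_def)
    next
      case 4
      then show ?thesis using ne ne' loops t Omega1_antisym[OF y(1), of "g w" "g v"]
        by (auto simp: d2_def algebra_simps)
    next
      case 5
      then have *: "(\<phi> (u b) - \<phi> (u a)) * y (a, b) = 0"
        using other Omega1D(1)[OF y(1), of "(a, b)"] by (cases "(a, b) \<in> parcs G") auto
      then show ?thesis unfolding * using 5 by auto
    qed
  qed
  have "2 * (d1 + d2) = (\<Sum>a\<in>pverts G. \<Sum>b\<in>pverts G.
        (if b = w then if a = v then d1 else 0 else 0) + (if b = v then if a = w then d1 else 0 else 0)
        + (if b = g w then if a = g v then d2 else 0 else 0)
        + (if b = g v then if a = g w then d2 else 0 else 0))"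
    using V pair_finite_verts by (simp add: sum.distrib)
  also have "\<dots> = (\<Sum>a\<in>pverts G. \<Sum>b\<in>pverts G. (\<phi> (u b) - \<phi> (u a)) * y (a, b))"
    by (intro sum.cong refl pt[symmetric])
  also have "\<dots> = - 2 * (\<Sum>x\<in>pverts G. \<phi> (u x) * divergence G y x)"
    using sum_gradient_eq_divergence[OF y(1), of "\<phi> \<circ> u"] by simp
  also have "\<dots> = 0"
  proof -
    have "\<phi> (u x) * divergence G y x = 0" if "x \<in> pverts G" for x
      using div[OF that] by (cases "divergence G y x = 0") (simp_all add: \<phi>_def)
    then have "(\<Sum>x\<in>pverts G. \<phi> (u x) * divergence G y x) = 0" by (intro sum.neutral ballI)
    then show ?thesis by (simp only: mult_zero_right)
  qed
  finally have "(\<phi> (u w) - \<phi> (u v)) + (\<phi> (u (g w)) - \<phi> (u (g v))) = 0"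
    using y(3) by (simp add: d1_def d2_def flip: distrib_right)
  \<comment> \<open>The equation reads \<open>-1 + of_bool (\<beta> = \<alpha>) - of_bool (\<beta> +
    1 = \<alpha>) = 0\<close>, so the middle term must be 1.\<close>
  then have \<beta>: "\<beta> = \<alpha>"
    unfolding uw ugv \<alpha>_def[symmetric] \<beta>_def[symmetric] \<phi>_def
    by (cases "\<beta> = \<alpha>"; cases "\<beta> + 1 = \<alpha>") simp_all
  have two: "u x = \<alpha> \<or> u x = \<alpha> + 1" if "x \<in> pverts G" for x
  proof (rule arc_closed_imp_all[OF V(1) _ _ that])
    show "u v = \<alpha> \<or> u v = \<alpha> + 1" by (simp add: \<alpha>_def)
    show "u b = \<alpha> \<or> u b = \<alpha> + 1" if "(a, b) \<in> parcs G" "u a = \<alpha> \<or> u a = \<alpha> + 1" for a b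
    proof (cases "(a, b) \<in> {(v, w), (w, v), (g v, g w), (g w, g v)}")
      case True
      then show ?thesis using uw ugv \<beta> \<alpha>_def \<beta>_def by auto
    next
      case False
      then show ?thesis using other[OF that(1)] that(2) by auto
    qed
  qed
  obtain n where n: "0 < n" "\<And>x. x \<in> pverts G \<Longrightarrow> (g ^^ n) x = x"
    using bij_betw_funpow_eq_id[OF pair_finite_verts bij] by blast
  note shift = arc_form_image[OF vw]
  have avg: "(\<Sum>i<n. u ((g ^^ i) x)) = n * u x0" if "x \<in> pverts G" for x
  proof -
    have "(\<Sum>i<n. u ((g ^^ i) x)) = (\<Sum>i<n. u ((g ^^ i) x0))"
      using u shift that x0(1) n(2)
      by (intro orbit_sum_constant[where f = "arc_form (g v, g w)"]) auto
    then show ?thesis using x0(2) by simp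
  qed
  \<comment> \<open>The average of \<open>u\<close> over every orbit is \<open>u x0\<close>; values
    lying all on one side of their average equal it.\<close>
  have zero: "u x = u x0"
    if "x \<in> pverts G" "(\<forall>i. 0 \<le> u ((g ^^ i) x) - u x0) \<or> (\<forall>i. u ((g ^^ i) x) - u x0 \<le> 0)" for x
  proof -
    have s: "(\<Sum>i<n. u ((g ^^ i) x) - u x0) = 0" using avg[OF that(1)] by (simp add: sum_subtractf)
    have "u ((g ^^ 0) x) - u x0 = 0"
      using that(2)
    proof
      assume "\<forall>i. 0 \<le> u ((g ^^ i) x) - u x0"
      then have "\<forall>i\<in>{..<n}. u ((g ^^ i) x) - u x0 = 0"
        using s by (subst (asm) sum_nonneg_eq_0_iff) simp_all
      then show ?thesis using n(1) by blast
    next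
      assume "\<forall>i. u ((g ^^ i) x) - u x0 \<le> 0"
      moreover have "(\<Sum>i<n. u x0 - u ((g ^^ i) x)) = 0"
        using s by (simp add: sum_subtractf)
      ultimately have "\<forall>i\<in>{..<n}. u x0 - u ((g ^^ i) x) = 0"
        by (subst (asm) sum_nonneg_eq_0_iff) simp_all
      then have "u x0 - u ((g ^^ 0) x) = 0" using n(1) by blast
      then show ?thesis by simp
    qed
    then show ?thesis by simp
  qed
  \<comment> \<open>Now \<open>u x0\<close> is the minimum or the maximum of \<open>u\<close>, so
    \<open>u\<close> would be constant; \<open>w\<close> or \<open>v\<close>, respectively, has the
    other value.\<close>
  from two[OF x0(1)] show False
  proof
    assume a: "u x0 = \<alpha>"
    have "0 \<le> u ((g ^^ i) w) - u x0" for i using two[OF funpow_vert[OF V(2), of i]] unfolding a by auto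
    then have "u w = u x0" by (intro zero[OF V(2)]) blast
    then show False unfolding a uw by simp
  next
    assume a: "u x0 = \<alpha> + 1"
    have "u ((g ^^ i) v) - u x0 \<le> 0" for i using two[OF funpow_vert[OF V(1), of i]] unfolding a by auto
    then have "u v = u x0" by (intro zero[OF V(1)]) blast
    then show False unfolding a \<alpha>_def by simp
  qed
qed

text \<open>The point \<open>x0\<close> required by \<open>arc_fixed\<close> is taken from the
  support of a second circulation \<open>z'\<close> that vanishes on the arc.\<close>

lemma cyclic_arc_fixed:
  assumes betti: "betti1 G \<ge> 2" and z: "z \<in> circulations G" "z (v, w) \<noteq> 0"
  shows "g v = v \<and> g w = w"
proof -
  have z1: "z \<in> Omega1 G" "\<And>x. x \<in> pverts G \<Longrightarrow> divergence G z x = 0"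
    using z(1) by (auto simp: circulations_def)
  have vw: "(v, w) \<in> parcs G" using Omega1D(1)[OF z1(1)] z(2) by blast
  obtain u where u: "\<And>a b. (a, b) \<in> parcs G \<Longrightarrow>
      u b - u a = arc_form (v, w) (a, b) - arc_form (g v, g w) (a, b)"
    using shift_potential[OF vw] by blast
  obtain z' where z': "z' \<in> circulations G" "z' \<noteq> 0" "z' (v, w) = 0"
    using circulation_vanishing_at[OF betti] by blast
  have z'1: "z' \<in> Omega1 G" "\<And>x. x \<in> pverts G \<Longrightarrow> divergence G z' x = 0"
    using z'(1) by (auto simp: circulations_def)
  have z'g: "z' (g v, g w) = 0"
    using pullback_eqD[OF circulation_invariant[OF z'(1)] vw] z'(3) by simp
  have supp: "(a, b) \<in> parcs G" if "z' (a, b) \<noteq> 0" for a b using Omega1D(1)[OF z'1(1)] that by blast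
  \<comment> \<open>By invariance \<open>z'\<close> vanishes on the image arc too, so its support
    avoids every arc along which \<open>u\<close> changes.\<close>
  have level: "u b = u a" if "z' (a, b) \<noteq> 0" for a b
  proof -
    have "(a, b) \<notin> {(v, w), (w, v), (g v, g w), (g w, g v)}"
      using that z'(3) z'g Omega1_antisym[OF z'1(1), of v w] Omega1_antisym[OF z'1(1), of "g v" "g w"]
      by auto
    then show ?thesis using u[OF supp[OF that]] by (auto simp: arc_form_def)
  qed
  have inv: "u (g a) = u a \<and> z' (g a, g b) \<noteq> 0" if ab: "z' (a, b) \<noteq> 0" for a b
  proof -
    \<comment> \<open>The part of \<open>z'\<close> on the level set of \<open>a\<close>. No flow
      crosses between levels, so this is again a circulation, hence invariant, and its support at
      \<open>g a\<close> shows that \<open>g a\<close> has the same level.\<close>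
    define zc where "zc = (\<lambda>(x, y). if u x = u a then z' (x, y) else 0)"
    have "zc \<in> Omega1 G"
    proof (rule Omega1I)
      show "zc x = 0" if "x \<notin> parcs G" for x
        using Omega1D(1)[OF z'1(1) that] by (cases x) (simp add: zc_def)
      show "zc (x, y) = - zc (y, x)" for x y
        using level[of x y] Omega1_antisym[OF z'1(1), of x y] by (cases "z' (x, y) = 0") (auto simp: zc_def)
    qed
    moreover have "divergence G zc x = 0" if "x \<in> pverts G" for x
      using z'1(2)[OF that] by (cases "u x = u a") (simp_all add: divergence_def zc_def)
    ultimately have "zc \<in> circulations G" by (simp add: circulations_def)
    then have "zc (g a, g b) = zc (a, b)"
      using pullback_eqD[OF circulation_invariant supp[OF ab]] by blast
    then show ?thesis using ab by (auto simp: zc_def split: if_splits)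
  qed
  obtain a b where ab: "z' (a, b) \<noteq> 0" using z'(2) by (auto simp: fun_eq_iff)
  have orbit: "u ((g ^^ i) a) = u a \<and> z' ((g ^^ i) a, (g ^^ i) b) \<noteq> 0" for i
    by (induction i) (use ab inv in auto)
  show ?thesis
    using arc_fixed[OF vw z1(1) circulation_invariant[OF z(1)] z(2) u, of a] orbit z1(2)
      in_arcsD1[OF supp[OF ab]] by auto
qed

section \<open>From cyclic vertices to the whole core\<close>

lemma cyclic_vert_fixed: "betti1 G \<ge> 2 \<Longrightarrow> x \<in> cyclic_verts G \<Longrightarrow> g x = x"
  using cyclic_arc_fixed unfolding cyclic_verts_def by blast

text \<open>The sources and sinks of the flow are cyclic, hence already fixed, so the flow is
  invariant although it need not be a circulation.\<close>

lemma core_arc_fixed: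
  assumes betti: "betti1 G \<ge> 2" and vw: "(v, w) \<in> parcs G" "v \<in> core_verts G" "w \<in> core_verts G"
  shows "g v = v \<and> g w = w"
proof -
  note fixed = cyclic_vert_fixed[OF betti]
  have XV: "cyclic_verts G \<subseteq> pverts G" using cyclic_verts_subset_core by blast
  obtain y where y: "y \<in> Omega1 G" "y (v, w) \<noteq> 0"
    "\<And>x. x \<notin> cyclic_verts G \<Longrightarrow> divergence G y x = 0"
    using core_arc_flow[OF vw] by blast
  have "divergence G y (g x) = divergence G y x" if x: "x \<in> pverts G" for x
  proof (cases "x \<in> cyclic_verts G")
    case False
    have "g x \<notin> cyclic_verts G"
    proof
      assume gx: "g x \<in> cyclic_verts G"
      then have "g x = x" using fixed[OF gx] g_eq_iff[OF _ x, of "g x"] XV by blast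
      then show False using gx False by simp
    qed
    then show ?thesis using y(3) False by simp
  qed (simp add: fixed)
  then have py: "pullback G g y = y" by (rule pullback_eq[OF y(1)])
  obtain u where u: "\<And>a b. (a, b) \<in> parcs G \<Longrightarrow>
      u b - u a = arc_form (v, w) (a, b) - arc_form (g v, g w) (a, b)"
    using shift_potential[OF vw(1)] by blast
  obtain x0 where x0: "x0 \<in> cyclic_verts G"
    using arc_side_meets_cyclic[OF vw] by blast
  have orbit: "(g ^^ i) x = x" if "x \<in> cyclic_verts G" for x i
    by (induction i) (use fixed[OF that] in auto)
  obtain n where n: "0 < n" "\<And>x. x \<in> pverts G \<Longrightarrow> (g ^^ n) x = x"
    using bij_betw_funpow_eq_id[OF pair_finite_verts bij] by blast
  note shift = arc_form_image[OF vw(1)]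
  \<comment> \<open>At a fixed vertex the orbit sum is \<open>n\<close> times the value of
    \<open>u\<close>, so equal orbit sums mean equal values.\<close>
  have const: "u x = u x0" if x: "x \<in> cyclic_verts G" for x
  proof -
    have "(\<Sum>i<n. u ((g ^^ i) x)) = (\<Sum>i<n. u ((g ^^ i) x0))"
      using u shift x x0 XV n(2)
      by (intro orbit_sum_constant[where f = "arc_form (g v, g w)"]) auto
    then show ?thesis using orbit[OF x] orbit[OF x0] n(1) by simp
  qed
  show ?thesis
  proof (rule arc_fixed[OF vw(1) y(1) py y(2) u])
    show "x0 \<in> pverts G" using x0 XV by blast
    show "u ((g ^^ i) x0) = u x0" for i by (simp only: orbit[OF x0])
    show "u x = u x0" if "divergence G y x \<noteq> 0" for x
      using const y(3) that by blast
  qed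
qed

text \<open>A nonzero circulation supplies a core vertex other than a non-cyclic \<open>x\<close>;
  so \<open>x\<close> is not isolated in the core and lies on a core arc.\<close>

lemma core_fixed:
  assumes "betti1 G \<ge> 2" "x \<in> core_verts G" shows "g x = x"
proof (cases "x \<in> cyclic_verts G")
  case False
  obtain z :: "'a \<times> 'a \<Rightarrow> real" where "z \<in> circulations G" "z \<noteq> 0"
    using circulation_vanishing_at[OF assms(1)] by blast
  then obtain y where y: "y \<in> cyclic_verts G" unfolding cyclic_verts_def by (auto simp: fun_eq_iff)
  then have "y \<in> core_verts G" "x \<noteq> y" using cyclic_verts_subset_core False by auto
  then show ?thesis
    using core_neighbour_exists[OF assms(2)] core_arc_fixed[OF assms(1) _ assms(2)] by blast
qed (rule cyclic_vert_fixed[OF assms(1)])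

end

section \<open>The kernel and the stabilizer\<close>

lemma mem_kernel_phi1_iff:
  assumes "pair_graph G"
  shows "g \<in> kernel (Aut G) (GL_H1 G) (phi1 G) \<longleftrightarrow>
    g \<in> graph_auts G \<and> (\<forall>f\<in>Omega1 G. \<exists>u. pullback G g f = f + coboundary G u)"
proof (cases "g \<in> graph_auts G")
  case True
  interpret pair_graph G by fact
  interpret L: group "GL_H1 G" by (rule group_GL_H1)
  have one: "\<one>\<^bsub>GL_H1 G\<^esub> = (\<lambda>X\<in>H1 G. X)" by (simp add: GL_H1_def BijGroup_def)
  have "g \<in> kernel (Aut G) (GL_H1 G) (phi1 G) \<longleftrightarrow> H1_pullback G g = (\<lambda>X\<in>H1 G. X)"
    using True L.inv_eq_1_iff[OF H1_pullback_GL[OF assms True]]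
    by (simp add: kernel_def Aut_def phi1_def one)
  also have "\<dots> \<longleftrightarrow> (\<forall>X\<in>H1 G. H1_pullback G g X = X)"
  proof
    assume *: "\<forall>X\<in>H1 G. H1_pullback G g X = X"
    show "H1_pullback G g = (\<lambda>X\<in>H1 G. X)"
      by (rule extensionalityI[of _ "H1 G"]) (use * in \<open>auto simp: H1_pullback_def\<close>)
  qed simp
  also have "\<dots> \<longleftrightarrow> (\<forall>f\<in>Omega1 G. H1_class G (pullback G g f) = H1_class G f)"
    using H1_pullback_class[OF pair_wf_digraph True] by (auto simp: H1_def)
  also have "\<dots> \<longleftrightarrow> (\<forall>f\<in>Omega1 G. \<exists>u. pullback G g f = f + coboundary G u)"
    unfolding H1_class_eq_iff by (simp add: image_iff algebra_simps)
  finally show ?thesis using True by simp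
qed (simp add: kernel_def Aut_def)

definition core_fixing_auts :: "'v pair_pre_digraph \<Rightarrow> ('v \<Rightarrow> 'v) set"
  where "core_fixing_auts G = {g \<in> graph_auts G. \<forall>x\<in>core_verts G. g x = x}"

lemma (in connected_pair_graph) kernel_phi1_eq:
  assumes "betti1 G \<ge> 2"
  shows "kernel (Aut G) (GL_H1 G) (phi1 G) = core_fixing_auts G"
proof (intro equalityI subsetI)
  fix g assume "g \<in> kernel (Aut G) (GL_H1 G) (phi1 G)"
  then have g: "g \<in> graph_auts G" "\<And>f. f \<in> Omega1 G \<Longrightarrow> \<exists>u. pullback G g f = f + coboundary G u"
    by (auto simp: mem_kernel_phi1_iff[OF pair_graph])
  interpret homologically_trivial G g by unfold_locales (use g in auto)
  show "g \<in> core_fixing_auts G"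
    using core_fixed[OF assms] g(1) by (simp add: core_fixing_auts_def)
next
  fix g assume "g \<in> core_fixing_auts G"
  then have g: "g \<in> graph_auts G" "\<And>x. x \<in> core_verts G \<Longrightarrow> g x = x"
    by (auto simp: core_fixing_auts_def)
  have "\<exists>u. pullback G g f = f + coboundary G u" if f: "f \<in> Omega1 G" for f
  proof -
    let ?h = "pullback G g f - f"
    have "?h \<in> Omega1 G" by (intro Omega1_diff pullback_Omega1[OF pair_graph g(1)] f)
    moreover have "?h (a, b) = 0 - 0"
      if "(a, b) \<in> parcs G" "a \<in> core_verts G" "b \<in> core_verts G" for a b
      using that(1) g(2)[OF that(2)] g(2)[OF that(3)] by (simp add: pullback_def)
    ultimately obtain u where "?h = coboundary G u"
      using potential_extend_core[of ?h "\<lambda>_. 0"] by blast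
    then show ?thesis by (intro exI[of _ u]) (simp add: algebra_simps)
  qed
  then show "g \<in> kernel (Aut G) (GL_H1 G) (phi1 G)"
    by (simp add: mem_kernel_phi1_iff[OF pair_graph] g(1))
qed

text \<open>A point of \<open>P\<close> sent outside \<open>P\<close> would share its image with
  that fixed image point, against injectivity.\<close>

lemma inj_on_fixing_Compl:
  assumes "inj_on g S" "P \<subseteq> S" "\<And>x. x \<in> S \<Longrightarrow> g x \<in> S" "\<And>x. x \<in> S - P \<Longrightarrow> g x = x" "x \<in> S"
  shows "g x \<in> P \<longleftrightarrow> x \<in> P"
  using assms by (metis DiffI inj_onD)

section \<open>Restriction to the forest part and extension from it\<close>

context pair_graph
begin

lemma pverts_forest_part_subset: "pverts (forest_part G) \<subseteq> pverts G"
  using pruned_subset[of G] in_arcsD2 by (auto simp: forest_part_def)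

lemma pruned_subset_forest_part: "pruned G \<subseteq> pverts (forest_part G)"
  by (auto simp: forest_part_def)

lemma intersection_verts_eq: "intersection_verts G = pverts (forest_part G) - pruned G"
  using pverts_forest_part_subset by (auto simp: intersection_verts_def cyc_part_def)

lemma mem_parcs_forest_part_iff:
  "(v, w) \<in> parcs (forest_part G) \<longleftrightarrow> (v, w) \<in> parcs G \<and> (v \<in> pruned G \<or> w \<in> pruned G)"
  by (simp add: forest_part_def)

lemma parcs_pruned_in_forest_part:
  assumes "(v, w) \<in> parcs G" "v \<in> pruned G \<or> w \<in> pruned G"
  shows "v \<in> pverts (forest_part G)" "w \<in> pverts (forest_part G)"
  using assms arc_sym[OF assms(1)] by (auto simp: forest_part_def)

text \<open>Fixing the core forces \<open>g\<close> to preserve the pruned set; the other vertices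
  of the forest part are core vertices and are fixed, so the forest part is preserved.\<close>

lemma restrict_in_forest_stabilizer:
  assumes "g \<in> core_fixing_auts G"
  shows "restrict g (pverts (forest_part G)) \<in> forest_stabilizer G"
proof -
  let ?F = "pverts (forest_part G)"
  have g: "bij_betw g (pverts G) (pverts G)" "\<And>x. x \<in> pverts G - pruned G \<Longrightarrow> g x = x"
    and ga: "\<And>v w. v \<in> pverts G \<Longrightarrow> w \<in> pverts G \<Longrightarrow> (g v, g w) \<in> parcs G \<longleftrightarrow> (v, w) \<in> parcs G"
    using assms by (auto simp: core_fixing_auts_def graph_auts_def Bij_def)
  have inj: "inj_on g (pverts G)" and mem: "\<And>x. x \<in> pverts G \<Longrightarrow> g x \<in> pverts G"
    using g(1) by (auto simp: bij_betw_def)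
  have P: "g x \<in> pruned G \<longleftrightarrow> x \<in> pruned G" if "x \<in> pverts G" for x
    by (rule inj_on_fixing_Compl[OF inj pruned_subset mem g(2) that])
  have F: "g x \<in> ?F" if "x \<in> ?F" for x
  proof (cases "x \<in> pruned G")
    case True
    then show ?thesis using P[of x] pruned_subset[of G] pruned_subset_forest_part by blast
  next
    case False
    then show ?thesis using that g(2)[of x] pverts_forest_part_subset by auto
  qed
  have injF: "inj_on g ?F" using inj pverts_forest_part_subset inj_on_subset by blast
  have finF: "finite ?F" using pverts_forest_part_subset pair_finite_verts finite_subset by blast
  have "g ` ?F = ?F" using F injF finF by (intro endo_inj_surj) auto
  then have "bij_betw (restrict g ?F) ?F ?F" using injF by (simp add: bij_betw_def)
  moreover have "(g v, g w) \<in> parcs (forest_part G) \<longleftrightarrow> (v, w) \<in> parcs (forest_part G)"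
    if "v \<in> ?F" "w \<in> ?F" for v w
  proof -
    have "v \<in> pverts G" "w \<in> pverts G" using that pverts_forest_part_subset by auto
    then show ?thesis by (simp add: mem_parcs_forest_part_iff ga P)
  qed
  moreover have "g x = x" if "x \<in> ?F - pruned G" for x
    using that g(2) pverts_forest_part_subset by auto
  ultimately show ?thesis
    by (simp add: forest_stabilizer_def Aut_def graph_auts_def Bij_def intersection_verts_eq)
qed

text \<open>An arc with a pruned end lies in the forest part, where \<open>s\<close> is an
  automorphism; any other arc joins two core vertices, which the extension fixes.\<close>

lemma forest_stabilizer_extends:
  assumes "s \<in> forest_stabilizer G"
  obtains g where "g \<in> core_fixing_auts G" "restrict g (pverts (forest_part G)) = s"
proof
  let ?F = "pverts (forest_part G)"
  let ?e = "\<lambda>x. if x \<in> ?F then s x else x"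
  \<comment> \<open>Members of \<open>Bij\<close> must be extensional; the total map
    \<open>?e\<close> is the one reasoned about.\<close>
  let ?g = "restrict ?e (pverts G)"
  have s: "bij_betw s ?F ?F" "s \<in> extensional ?F" "\<And>x. x \<in> ?F - pruned G \<Longrightarrow> s x = x"
    and sa: "\<And>v w. v \<in> ?F \<Longrightarrow> w \<in> ?F \<Longrightarrow>
      (s v, s w) \<in> parcs (forest_part G) \<longleftrightarrow> (v, w) \<in> parcs (forest_part G)"
    using assms
    by (auto simp: forest_stabilizer_def Aut_def graph_auts_def Bij_def intersection_verts_eq)
  have inj: "inj_on s ?F" and mem: "\<And>x. x \<in> ?F \<Longrightarrow> s x \<in> ?F"
    using s(1) by (auto simp: bij_betw_def)
  have P: "s x \<in> pruned G \<longleftrightarrow> x \<in> pruned G" if "x \<in> ?F" for x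
    by (rule inj_on_fixing_Compl[OF inj pruned_subset_forest_part mem s(3) that])
  have eF: "?e x \<in> ?F \<longleftrightarrow> x \<in> ?F" for x using mem by simp
  have eP: "?e x \<in> pruned G \<longleftrightarrow> x \<in> pruned G" for x
    using P pruned_subset_forest_part by auto
  have efix: "?e x = x" if "x \<notin> pruned G" for x using s(3) that by simp
  have "bij_betw ?e ?F ?F" using s(1) by (simp cong: bij_betw_cong)
  moreover have "bij_betw ?e (pverts G - ?F) (pverts G - ?F)"
    by (rule bij_betw_cong[THEN iffD1, OF _ bij_betw_id]) simp
  ultimately have "bij_betw ?e (?F \<union> (pverts G - ?F)) (?F \<union> (pverts G - ?F))"
    by (rule bij_betw_combine) blast
  moreover have "?F \<union> (pverts G - ?F) = pverts G" using pverts_forest_part_subset by blast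
  ultimately have bij: "bij_betw ?e (pverts G) (pverts G)" by simp
  have arcs: "(?e v, ?e w) \<in> parcs G \<longleftrightarrow> (v, w) \<in> parcs G" for v w
  proof (cases "v \<in> pruned G \<or> w \<in> pruned G")
    case True
    then have eT: "?e v \<in> pruned G \<or> ?e w \<in> pruned G" by (simp only: eP)
    show ?thesis
    proof (cases "v \<in> ?F \<and> w \<in> ?F")
      case vw: True
      then show ?thesis
        using sa[of v w] True eT by (simp add: mem_parcs_forest_part_iff)
    next
      case False
      then have "\<not> (?e v \<in> ?F \<and> ?e w \<in> ?F)" by (simp only: eF) simp
      then have "(?e v, ?e w) \<notin> parcs G" using parcs_pruned_in_forest_part eT by blast
      moreover have "(v, w) \<notin> parcs G" using parcs_pruned_in_forest_part True False by blast
      ultimately show ?thesis by blast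
    qed
  next
    case False
    then show ?thesis using efix[of v] efix[of w] by (simp del: if_split)
  qed
  show "?g \<in> core_fixing_auts G"
    using bij arcs efix by (simp add: core_fixing_auts_def graph_auts_def Bij_def del: if_split)
  show "restrict ?g ?F = s"
    using s(2) pverts_forest_part_subset
    by (auto simp: fun_eq_iff extensional_def restrict_def)
qed

text \<open>Restriction is injective since every vertex outside the forest part is a fixed core
  vertex, and multiplicative since the forest part is preserved.\<close>

lemma core_fixing_auts_iso:
  "(Aut G)\<lparr>carrier := core_fixing_auts G\<rparr>
    \<cong> (Aut (forest_part G))\<lparr>carrier := forest_stabilizer G\<rparr>"
proof -
  let ?F = "pverts (forest_part G)"
  let ?r = "\<lambda>g. restrict g ?F"
  have fixF: "g x \<in> ?F" if "g \<in> core_fixing_auts G" "x \<in> ?F" for g x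
    using restrict_in_forest_stabilizer[OF that(1)] that(2)
    by (auto simp: forest_stabilizer_def Aut_def graph_auts_def Bij_def bij_betw_def)
  have inj: "inj_on ?r (core_fixing_auts G)"
  proof (rule inj_onI)
    fix g h assume gh: "g \<in> core_fixing_auts G" "h \<in> core_fixing_auts G" "?r g = ?r h"
    show "g = h"
    proof (rule extensionalityI[of _ "pverts G"])
      show "g \<in> extensional (pverts G)" "h \<in> extensional (pverts G)"
        using gh by (auto simp: core_fixing_auts_def graph_auts_def Bij_def)
      show "g x = h x" if "x \<in> pverts G" for x
      proof (cases "x \<in> ?F")
        case True
        then show ?thesis using fun_cong[OF gh(3), of x] by simp
      next
        case False
        then have "x \<in> core_verts G" using that pruned_subset_forest_part by blast
        then show ?thesis using gh(1,2) by (auto simp: core_fixing_auts_def)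
      qed
    qed
  qed
  have "?r ` core_fixing_auts G = forest_stabilizer G"
  proof
    show "?r ` core_fixing_auts G \<subseteq> forest_stabilizer G"
      using restrict_in_forest_stabilizer by blast
    show "forest_stabilizer G \<subseteq> ?r ` core_fixing_auts G"
    proof
      fix s assume "s \<in> forest_stabilizer G"
      then obtain g where "g \<in> core_fixing_auts G" "?r g = s" by (rule forest_stabilizer_extends)
      then show "s \<in> ?r ` core_fixing_auts G" by blast
    qed
  qed
  then have bij: "bij_betw ?r (core_fixing_auts G) (forest_stabilizer G)"
    using inj by (simp add: bij_betw_def)
  have hom: "?r (g \<otimes>\<^bsub>Aut G\<^esub> h) = ?r g \<otimes>\<^bsub>Aut (forest_part G)\<^esub> ?r h"
    if g: "g \<in> core_fixing_auts G" and h: "h \<in> core_fixing_auts G" for g h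
  proof -
    have "g \<in> Bij (pverts G)" "h \<in> Bij (pverts G)"
      using g h by (auto simp: core_fixing_auts_def graph_auts_def)
    moreover have "?r g \<in> Bij ?F" "?r h \<in> Bij ?F"
      using restrict_in_forest_stabilizer g h
      by (auto simp: forest_stabilizer_def Aut_def graph_auts_def)
    ultimately have "g \<otimes>\<^bsub>Aut G\<^esub> h = compose (pverts G) g h"
      "?r g \<otimes>\<^bsub>Aut (forest_part G)\<^esub> ?r h = compose ?F (?r g) (?r h)"
      by (simp_all add: Aut_def BijGroup_def)
    then show ?thesis
      using fixF[OF h] pverts_forest_part_subset by (auto simp: compose_def fun_eq_iff)
  qed
  have "?r \<in> iso ((Aut G)\<lparr>carrier := core_fixing_auts G\<rparr>)
      ((Aut (forest_part G))\<lparr>carrier := forest_stabilizer G\<rparr>)"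
    using bij hom restrict_in_forest_stabilizer by (auto simp: iso_def hom_def)
  then show ?thesis by (auto simp: is_iso_def)
qed

end

theorem theorem3p14:
  fixes G :: "'v pair_pre_digraph"
  assumes "pair_graph G"
    and "connected (with_proj G)"
    and "betti1 G \<ge> 2"
  shows "(Aut G)\<lparr>carrier := kernel (Aut G) (GL_H1 G) (phi1 G)\<rparr>
    \<cong> (Aut (forest_part G))\<lparr>carrier := forest_stabilizer G\<rparr>"
proof -
  interpret connected_pair_graph G
    using assms(1,2) by (simp add: connected_pair_graph_def connected_pair_graph_axioms_def)
  show ?thesis unfolding kernel_phi1_eq[OF assms(3)] by (rule core_fixing_auts_iso)
qed

end
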